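(* Let $0<\alpha<1$. Let $g$ be an unbounded convex mapping with $g(1)=\infty$. If $g(\mathbb{D})$ has angle at infinity equal to $\pi\alpha$, then there exists $\delta>0$ such that $$|1-z|^\alpha|g(z)|\ge\delta$$ as $z\to1$, that is, for all $z\in\mathbb{D}$ sufficiently close to $1$.
   Context: Let $\mathbb{D}$ be the open unit disk in $\mathbb{C}$. A convex mapping is a univalent (injective) holomorphic function on $\mathbb{D}$ whose range is a convex set; it is unbounded if its range is an unbounded set. Such a mapping extends continuously, in the spherical metric, to the closed unit disk with values in the Riemann sphere, and $g(1)=\infty$ refers to this extension. The angle at infinity of an unbounded convex set is the infimum of the (opening) angles of all sectors containing that set, a sector being a planar region bounded by two rays issuing from a common vertex. *)

theory Defs
  imports "HOL-Complex_Analysis.Complex_Analysis"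
begin

definition convex_mapping :: "(complex \<Rightarrow> complex) \<Rightarrow> bool" where
  "convex_mapping g \<longleftrightarrow>
     g holomorphic_on ball 0 1 \<and> inj_on g (ball 0 1) \<and> convex (g ` ball 0 1)"

definition unbounded_convex_mapping :: "(complex \<Rightarrow> complex) \<Rightarrow> bool" where
  "unbounded_convex_mapping g \<longleftrightarrow> convex_mapping g \<and> \<not> bounded (g ` ball 0 1)"

(* The open region swept out counterclockwise from the ray of direction cis a to the ray of
   direction cis (a + \<theta>), both issuing from w. It is a sector of opening angle \<theta>
   only for 0 < \<theta> < 2 * pi; \<theta> = pi gives a half-plane. *)
definition sector :: "complex \<Rightarrow> real \<Rightarrow> real \<Rightarrow> complex set" where
  "sector w a \<theta> = {w + of_real r * cis t | r t. 0 < r \<and> a < t \<and> t < a + \<theta>}"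

(* Meaningful only for sets contained in some sector, as every convex proper subset of the
   plane that is open is; otherwise the infimum is over the empty set and has no specified
   value. *)
definition angle_at_infinity :: "complex set \<Rightarrow> real" where
  "angle_at_infinity S = Inf {\<theta>. 0 < \<theta> \<and> \<theta> < 2 * pi \<and> (\<exists>w a. S \<subseteq> sector w a \<theta>)}"

end

theory Submission
  imports Defs
begin

text \<open>The exponent comes from the geometry of the range \<open>S\<close> of \<open>g\<close>. That \<open>S\<close> has angle
\<open>pi * \<alpha>\<close> at infinity implies that translation in each direction of some arc of length
\<open>pi * \<alpha>\<close> maps \<open>S\<close> into itself (lemma \<open>recession_arc\<close>). Such a translation induces a
holomorphic self-map of the disc. Far out in the middle of the recession cone, \<open>S\<close> contains huge balls,
so there a fixed translation is a very short move in the hyperbolic metric. Julia's lemma then shows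
that all these self-maps preserve the horodiscs at one common boundary point \<open>\<xi>\<close> (lemmas
\<open>translation_increases_Re\<close> and \<open>common_boundary_point\<close>).

Now pass to the right half-plane with \<open>\<xi>\<close> at infinity, and let \<open>F\<close> be \<open>g\<close> in this coordinate,
followed by a rotation. The horodiscs become half-planes \<open>Re w > c\<close>. That they are preserved by small
translations in a given direction says that \<open>F'\<close> makes an angle of at most \<open>pi / 2\<close> with that
direction. As this holds for an arc of directions of length \<open>pi * \<alpha>\<close>, the values of \<open>F'\<close> lie
in a sector of angle \<open>pi * (1 - \<alpha>)\<close> (lemma \<open>half_plane_model\<close>). So the power
\<open>1 / (1 - \<alpha>)\<close> of \<open>F'\<close> has nonnegative real part, and Harnack-type bounds for it and for its
reciprocal bound \<open>F'\<close> from both sides (lemma \<open>narrow_range_estimates\<close>).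

The upper bound makes \<open>F'\<close> integrable up to each finite boundary point. Hence \<open>F\<close> does not tend to
infinity there, and as \<open>g\<close> tends to infinity at \<open>1\<close>, the point \<open>\<xi>\<close> must be \<open>1\<close> (lemma
\<open>boundary_point_eq_one\<close>). The lower bound gives \<open>cmod (F w) \<ge> \<delta> * cmod w powr \<alpha>\<close> for large \<open>w\<close>,
also for \<open>w\<close> close to the imaginary axis, because \<open>F'\<close> stays in a sector of angle less than
\<open>pi\<close> and so increments of \<open>F\<close> in nearly the same direction do not cancel (lemma
\<open>growth_in_half_plane\<close>). In the disc \<open>w = (1 + z) / (1 - z)\<close>, and \<open>cmod w\<close> is
comparable to the reciprocal of \<open>cmod (1 - z)\<close>, which is the claim.\<close>

section \<open>The recession cone of a convex set with given angle at infinity\<close>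

text \<open>The number \<open>Im (x * cis (- b))\<close> is the inner product of \<open>x\<close> with the unit vector
\<open>\<i> * cis b\<close>, so the predicate says that \<open>S\<close> lies to the right of some line
of direction \<open>cis b\<close>. The two sides of \<open>sector w a \<theta>\<close>, oriented so that the sector is to
their right, have the directions \<open>a + pi\<close> and \<open>a + \<theta>\<close>.\<close>

definition bounded_in_direction :: "complex set \<Rightarrow> real \<Rightarrow> bool" where
  "bounded_in_direction S b \<longleftrightarrow> (\<exists>c. \<forall>x\<in>S. Im (x * cis (- b)) < c)"

lemma bounded_in_direction_cong:
  assumes "cis b = cis b'" "bounded_in_direction S b"
  shows "bounded_in_direction S b'"
  using assms by (simp add: bounded_in_direction_def flip: cis_inverse)

text \<open>The outer normals of half-planes containing \<open>S\<close> form a convex cone. Here the normal of the middle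
direction is written as a nonnegative combination of the two outer ones by means of the sine rule;
this is where the two directions must be less than \<open>pi\<close> apart.\<close>

lemma bounded_in_direction_between:
  assumes "bounded_in_direction S b" "bounded_in_direction S b'"
    and "b \<le> m" "m \<le> b'" "b' < b + pi"
  shows "bounded_in_direction S m"
proof (cases "b = b'")
  case True
  with assms show ?thesis by simp
next
  case False
  with assms have "b < b'" by simp
  obtain c c' where c: "\<forall>x\<in>S. Im (x * cis (- b)) < c" and c': "\<forall>x\<in>S. Im (x * cis (- b')) < c'"
    using assms(1,2) by (auto simp: bounded_in_direction_def)
  define s p q where "s = sin (b' - b)" and "p = sin (b' - m)" and "q = sin (m - b)"
  have s: "s > 0" unfolding s_def using \<open>b < b'\<close> assms by (intro sin_gt_zero) auto
  have pq: "p \<ge> 0" "q \<ge> 0" unfolding p_def q_def using assms by (auto intro!: sin_ge_zero)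
  have comb: "of_real s * cis (- m) = of_real p * cis (- b) + of_real q * cis (- b')"
  proof -
    have 1: "sin b * sin b + cos b * cos b = 1" "sin b' * sin b' + cos b' * cos b' = 1"
        "sin m * sin m + cos m * cos m = 1"
      using sin_cos_squared_add[of b] sin_cos_squared_add[of b'] sin_cos_squared_add[of m]
      by (simp_all add: power2_eq_square)
    have "sin (b' - b) * cos m = sin (b' - m) * cos b + sin (m - b) * cos b'"
      unfolding sin_diff by algebra
    moreover have "sin (b' - b) * sin m = sin (b' - m) * sin b + sin (m - b) * sin b'"
      unfolding sin_diff by algebra
    ultimately show ?thesis
      by (simp add: s_def p_def q_def complex_eq_iff)
  qed
  have "Im (x * cis (- m)) < (p * c + q * c') / s + 1" if "x \<in> S" for x
  proof -
    have "s * Im (x * cis (- m)) = Im (x * (of_real s * cis (- m)))" 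
      by (simp add: algebra_simps)
    also have "\<dots> = p * Im (x * cis (- b)) + q * Im (x * cis (- b'))"
      unfolding comb by (simp add: algebra_simps)
    also have "\<dots> \<le> p * c + q * c'"
      using c c' pq that by (intro add_mono mult_left_mono) (auto intro: less_imp_le)
    finally have "Im (x * cis (- m)) \<le> (p * c + q * c') / s"
      using s by (simp add: field_simps)
    then show ?thesis by simp
  qed
  then show ?thesis unfolding bounded_in_direction_def by blast
qed

lemma sector_imp_bounded_in_direction:
  assumes "S \<subseteq> sector w a \<theta>" "0 < \<theta>" "\<theta> < pi"
  shows "bounded_in_direction S (a + pi)" "bounded_in_direction S (a + \<theta>)"
proof -
  have "Im (x * cis (- (a + pi))) < Im (w * cis (- (a + pi)))
      \<and> Im (x * cis (- (a + \<theta>))) < Im (w * cis (- (a + \<theta>)))" if xS: "x \<in> S" for x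
  proof -
    obtain r t where x: "x = w + of_real r * cis t" and r: "0 < r" and t: "a < t" "t < a + \<theta>"
      using xS assms(1) unfolding sector_def by blast
    have *: "Im (x * cis (- u)) = Im (w * cis (- u)) + r * sin (t - u)" for u
      by (simp add: x algebra_simps sin_diff)
    moreover have "sin (t - (a + pi)) < 0" 
      using sin_gt_zero[of "t - a"] t assms by (simp add: sin_diff sin_add cos_add)
    moreover have "sin (t - (a + \<theta>)) < 0"
      using sin_gt_zero[of "(a + \<theta>) - t"] t assms by (simp add: sin_diff mult.commute)
    ultimately show ?thesis unfolding * using r by (simp add: mult_pos_neg)
  qed
  then show "bounded_in_direction S (a + pi)" "bounded_in_direction S (a + \<theta>)"
    unfolding bounded_in_direction_def by blast+
qed

text \<open>A sector of angle less than \<open>pi\<close> is the intersection of two half-planes, and the sector of angle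
\<open>pi\<close> is one half-plane.\<close>

lemma mem_sectorI:
  assumes "0 < Im ((x - w) * cis (- a))" "0 < \<theta>" 
    and "\<theta> < pi \<and> Im ((x - w) * cis (- (a + \<theta>))) < 0 \<or> \<theta> = pi"
  shows "x \<in> sector w a \<theta>"
proof -
  define y where "y = (x - w) * cis (- a)"
  have A: "0 < Arg y" "Arg y < pi" "y \<noteq> 0" using assms(1) Arg_lt_pi[of y] by (auto simp: y_def)
  have "x - w = y * cis a"
    unfolding y_def by (simp add: mult.assoc cis_mult)
  also have "\<dots> = rcis (cmod y) (Arg y) * cis a"
    by (simp only: rcis_cmod_Arg)
  also have "\<dots> = of_real (cmod y) * cis (a + Arg y)"
    by (simp only: rcis_def mult.assoc cis_mult add.commute)
  finally have xw: "x - w = of_real (cmod y) * cis (a + Arg y)" .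
  have "Arg y < \<theta>"
  proof (rule ccontr)
    assume "\<not> ?thesis"
    then have *: "\<theta> < pi" "\<theta> \<le> Arg y" "Im ((x - w) * cis (- (a + \<theta>))) < 0" using assms A by auto
    have "Im ((x - w) * cis (- (a + \<theta>))) = cmod y * sin (Arg y - \<theta>)"
      unfolding xw by (simp only: mult.assoc cis_mult) (simp add: algebra_simps)
    moreover have "sin (Arg y - \<theta>) \<ge> 0"
      using * A assms(2) by (intro sin_ge_zero) auto
    ultimately show False using * by (simp add: mult_less_0_iff)
  qed
  then show ?thesis
    unfolding sector_def using xw A 
    by (intro CollectI exI[of _ "cmod y"] exI[of _ "a + Arg y"]) (auto simp: algebra_simps)
qed

text \<open>Two half-planes with non-parallel sides meet in a sector; its vertex \<open>w\<close> is found by solving for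
the intersection of the two boundary lines in the basis \<open>cis b\<close>, \<open>cis b'\<close>.\<close>

lemma bounded_in_direction_imp_sector:
  assumes "bounded_in_direction S b" "bounded_in_direction S b'" "b < b'" "b' < b + pi"
  obtains w where "S \<subseteq> sector w (b' - pi) (pi - (b' - b))"
proof -
  obtain c c' where c: "\<forall>x\<in>S. Im (x * cis (- b)) < c" and c': "\<forall>x\<in>S. Im (x * cis (- b')) < c'"
    using assms(1,2) by (auto simp: bounded_in_direction_def)
  define s where "s = sin (b' - b)"
  have s: "s > 0" unfolding s_def using assms by (intro sin_gt_zero) auto
  define w where "w = of_real (c / s) * cis b' - of_real (c' / s) * cis b"
  have w1: "Im (w * cis (- b)) = c"
    using s by (simp add: w_def s_def sin_diff field_simps)
  have w2: "Im (w * cis (- b')) = c'"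
    using s by (simp add: w_def s_def sin_diff field_simps)
  have "x \<in> sector w (b' - pi) (pi - (b' - b))" if "x \<in> S" for x
  proof -
    have 1: "(x - w) * cis (- (b' - pi)) = - ((x - w) * cis (- b'))"
      by (simp add: complex_eq_iff cos_diff sin_diff)
    have 2: "b' - pi + (pi - (b' - b)) = b" by simp
    show ?thesis
    proof (rule mem_sectorI)
      show "0 < Im ((x - w) * cis (- (b' - pi)))"
        unfolding 1 using c' that w2 by (simp add: left_diff_distrib)
      have "Im ((x - w) * cis (- (b' - pi + (pi - (b' - b))))) < 0"
        unfolding 2 using c that w1 by (simp add: left_diff_distrib)
      then show "pi - (b' - b) < pi \<and> Im ((x - w) * cis (- (b' - pi + (pi - (b' - b))))) < 0
          \<or> pi - (b' - b) = pi"
        using assms by simp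
    qed (use assms in auto)
  qed
  then show ?thesis using that by blast
qed

text \<open>This is the form in which the angle at infinity enters: an infimum over sectors becomes an upper
bound for the angular spread of the half-planes containing \<open>S\<close>.\<close>

lemma bounded_in_direction_gap:
  assumes "bounded_in_direction S b" "bounded_in_direction S b'" "b < b'" "b' < b + pi"
  shows "b' - b \<le> pi - angle_at_infinity S"
proof -
  obtain w where w: "S \<subseteq> sector w (b' - pi) (pi - (b' - b))"
    using bounded_in_direction_imp_sector assms by blast
  have "angle_at_infinity S \<le> pi - (b' - b)"
    unfolding angle_at_infinity_def
  proof (rule cInf_lower)
    show "pi - (b' - b) \<in> {\<theta>. 0 < \<theta> \<and> \<theta> < 2 * pi \<and> (\<exists>w a. S \<subseteq> sector w a \<theta>)}"
      using w assms by auto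
    show "bdd_below {\<theta>. 0 < \<theta> \<and> \<theta> < 2 * pi \<and> (\<exists>w a. S \<subseteq> sector w a \<theta>)}"
      by (rule bdd_belowI[of _ 0]) auto
  qed
  then show ?thesis by simp
qed

text \<open>If \<open>cis t\<close> is not a recession direction of \<open>S\<close>, a point at which the ray in that direction has
left \<open>S\<close> can be separated from \<open>S\<close>, and the separating functional increases in the direction
\<open>cis t\<close>. Since \<open>S\<close> is open, it increases strictly, which gives the strict bounds on \<open>m\<close>.\<close>

lemma bounded_in_direction_separation:
  assumes "open S" "convex S" "p \<in> S" "0 \<le> r" "p + of_real r * cis t \<notin> S"
  obtains m where "bounded_in_direction S m" "t - pi < m" "m < t"
proof -
  obtain a b where a: "a \<noteq> 0" and b: "\<And>x. x \<in> S \<Longrightarrow> inner a x \<le> b"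
      and q: "inner a (p + of_real r * cis t) \<ge> b"
    using separating_hyperplane_sets[of S "{p + of_real r * cis t}"] assms by auto
  \<comment> \<open>Moving \<open>p\<close> a little along the normal makes the separation strict.\<close>
  obtain e where e: "e > 0" "cball p e \<subseteq> S"
    using assms(1,3) open_contains_cball by blast
  define n where "n = sgn a"
  have n: "norm n = 1" "a = of_real (norm a) * n"
    using a by (simp_all add: n_def norm_sgn) (simp add: sgn_eq)
  have "p + of_real e * n \<in> S"
    using e n by (intro subsetD[OF e(2)]) (simp add: dist_norm norm_mult)
  then have "inner a (p + of_real e * n) \<le> b" by (rule b)
  moreover have "inner a (of_real e * n) = e * norm a"
  proof -
    have "inner a (of_real e * n) = e * (norm a * inner n n)"
      by (subst n(2)) (simp add: inner_complex_def algebra_simps)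
    then show ?thesis using n(1) by (simp add: norm_eq_sqrt_inner)
  qed
  ultimately have "inner a (of_real r * cis t) \<ge> e * norm a"
    using q by (simp add: inner_add_right)
  then have "inner a (of_real r * cis t) > 0"
    using e a less_le_trans[OF mult_pos_pos[of e "norm a"]] by simp
  then have "r * inner a (cis t) > 0"
    by (simp add: inner_complex_def algebra_simps)
  then have pos: "inner a (cis t) > 0"
    using assms(4) by (simp add: zero_less_mult_iff)
  define s where "s = Arg (cis t * cnj n)"
  have nz: "cis t * cnj n \<noteq> 0" using n by auto
  have "Re (cis t * cnj n) > 0"
  proof -
    have "inner a (cis t) = norm a * Re (cis t * cnj n)"
      by (subst n(2)) (simp add: inner_complex_def algebra_simps)
    with pos a show ?thesis by (simp add: zero_less_mult_iff)
  qed
  then have s: "\<bar>s\<bar> < pi / 2" unfolding s_def using Arg_Re_pos by blast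
  have "cis s = cis t * cnj n"
    unfolding s_def using cis_Arg[OF nz] n by (simp add: sgn_eq norm_mult)
  then have cn: "cnj n = cis (- t) * cis s"
    by (simp add: mult.assoc[symmetric] cis_mult)
  have "bounded_in_direction S (t - s - pi / 2)"
    unfolding bounded_in_direction_def
  proof (intro exI ballI)
    fix x assume "x \<in> S"
    have "cis (- (t - s - pi / 2)) = cis (pi / 2 + (- t + s))"
      by (rule arg_cong[of _ _ cis]) simp
    also have "\<dots> = cis (pi / 2) * (cis (- t) * cis s)"
      unfolding cis_mult ..
    finally have "cis (- (t - s - pi / 2)) = \<i> * cnj n"
      unfolding cn by simp
    then have "Im (x * cis (- (t - s - pi / 2))) = Re (x * cnj n)"
      by simp
    also have "\<dots> = inner a x / norm a"
      using a by (subst n(2)) (simp add: inner_complex_def norm_mult n(1) field_simps)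
    also have "\<dots> \<le> b / norm a"
      using b[OF \<open>x \<in> S\<close>] by (simp add: divide_right_mono)
    finally show "Im (x * cis (- (t - s - pi / 2))) < b / norm a + 1" by simp
  qed
  then show ?thesis
    using s by (intro that[of "t - s - pi / 2"]) auto
qed

lemma sector_rotate:
  assumes "cis a = cis a'"
  shows "sector w a \<theta> \<subseteq> sector w a' \<theta>"
proof
  fix x assume "x \<in> sector w a \<theta>"
  then obtain r t where x: "x = w + of_real r * cis t" "0 < r" "a < t" "t < a + \<theta>"
    by (auto simp: sector_def)
  have "cis (t + (a' - a)) = cis t"
    using assms by (simp flip: cis_mult cis_divide)
  then show "x \<in> sector w a' \<theta>"
    unfolding sector_def using x by (intro CollectI exI[of _ r] exI[of _ "t + (a' - a)"]) auto
qed

text \<open>The infimum that defines the angle at infinity is over a nonempty set, because a proper open convex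
set lies in a half-plane. The direction of the sector is normalised to \<open>[- pi, pi]\<close> so that a
sequence of such sectors has a convergent subsequence of directions.\<close>

lemma sector_contains_near_angle:
  assumes "convex S" "S \<noteq> UNIV" "angle_at_infinity S < \<theta>'" "open S"
  obtains \<theta> w a where "angle_at_infinity S \<le> \<theta>" "\<theta> < \<theta>'" "S \<subseteq> sector w a \<theta>" "- pi \<le> a" "a \<le> pi"
proof -
  let ?T = "{\<theta>. 0 < \<theta> \<and> \<theta> < 2 * pi \<and> (\<exists>w a. S \<subseteq> sector w a \<theta>)}"
  have bdd: "bdd_below ?T" by (rule bdd_belowI[of _ 0]) auto
  have "?T \<noteq> {}"
  proof (cases "S = {}")
    case True
    then have "1 \<in> ?T" using pi_gt3 by auto
    then show ?thesis by blast
  next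
    case False
    then obtain p q where p: "p \<in> S" and q: "q \<notin> S" using assms by blast
    have "p + of_real (cmod (q - p)) * cis (Arg (q - p)) = q"
      using rcis_cmod_Arg[of "q - p"] by (simp add: rcis_def)
    with q have "p + of_real (cmod (q - p)) * cis (Arg (q - p)) \<notin> S" by simp
    then obtain m where "bounded_in_direction S m"
      using bounded_in_direction_separation[OF assms(4,1) p norm_ge_zero] by blast
    then obtain c where c: "\<And>x. x \<in> S \<Longrightarrow> Im (x * cis (- m)) < c"
      by (auto simp: bounded_in_direction_def)
    define w where "w = \<i> * of_real c * cis m"
    have "S \<subseteq> sector w (m - pi) pi"
    proof
      fix x assume "x \<in> S"
      have 1: "(x - w) * cis (- (m - pi)) = - ((x - w) * cis (- m))"
        by (simp add: complex_eq_iff cos_diff sin_diff)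
      have 2: "w * cis (- m) = \<i> * of_real c"
        by (simp add: w_def mult.assoc cis_mult)
      have "0 < Im ((x - w) * cis (- (m - pi)))"
        unfolding 1 unfolding left_diff_distrib 2 using c[OF \<open>x \<in> S\<close>] by simp
      then show "x \<in> sector w (m - pi) pi"
        by (intro mem_sectorI) simp_all
    qed
    then have "pi \<in> ?T" by auto
    then show ?thesis by blast
  qed
  then have "\<exists>\<theta>\<in>?T. \<theta> < \<theta>'"
    using assms(3) unfolding angle_at_infinity_def by (rule cInf_lessD)
  then obtain \<theta> where \<theta>: "\<theta> \<in> ?T" "\<theta> < \<theta>'" by (elim bexE)
  then obtain w a where wa: "S \<subseteq> sector w a \<theta>" by auto
  have "cis a = cis (Arg (cis a))" by (simp add: cis_Arg)
  then have "S \<subseteq> sector w (Arg (cis a)) \<theta>" using sector_rotate wa by blast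
  moreover have "angle_at_infinity S \<le> \<theta>"
    unfolding angle_at_infinity_def by (rule cInf_lower[OF \<theta>(1) bdd])
  ultimately show ?thesis
    using \<theta> by (intro that[of \<theta> w "Arg (cis a)"]) (auto simp: Arg_le_pi mpi_less_Arg less_imp_le)
qed

text \<open>Suppose that \<open>S\<close> lies in a sector of angle \<open>\<theta>\<close> slightly above the angle \<open>A\<close> at infinity and
that \<open>cis t\<close>, well inside the sector, is not a recession direction. The half-plane that witnesses
this, of direction \<open>m\<close>, cuts the sector down. Together with one side of the sector, or with a
half-plane between the two sides, it bounds a sector of angle less than \<open>A\<close> that still contains
\<open>S\<close>, which is impossible.\<close>

lemma recession_direction_in_near_sector:
  assumes "open S" "convex S" "0 < angle_at_infinity S" 
    and sec: "S \<subseteq> sector w a \<theta>" "angle_at_infinity S \<le> \<theta>" "\<theta> < pi"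
    and t: "a + \<theta> - angle_at_infinity S < t" "t < a + angle_at_infinity S"
    and p: "p \<in> S" "0 \<le> r"
  shows "p + of_real r * cis t \<in> S"
proof (rule ccontr)
  define A where "A = angle_at_infinity S"
  assume "\<not> ?thesis"
  then obtain m where m: "bounded_in_direction S m" "t - pi < m" "m < t"
    using bounded_in_direction_separation[of S p r t] assms by blast
  define b b' where "b = a + \<theta>" and "b' = a + pi"
  have th: "0 < \<theta>" using assms by simp
  have b: "bounded_in_direction S b" and b': "bounded_in_direction S b'"
    using sector_imp_bounded_in_direction[OF sec(1) th sec(3)] by (auto simp: b_def b'_def)
  have m2: "bounded_in_direction S (m + 2 * pi)"
    by (rule bounded_in_direction_cong[OF _ m(1)]) (simp add: complex_eq_iff)
  have gap: "v - u \<le> pi - A" if "bounded_in_direction S u" "bounded_in_direction S v" "u < v" "v < u + pi" for u v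
    using bounded_in_direction_gap that unfolding A_def by blast
  have order: "A > 0" "t > b - A" "t < b' - pi + A" "b < b'" "b' < b + pi" "A \<le> \<theta>"
    using assms th by (auto simp: A_def b_def b'_def)
  \<comment> \<open>The sector has the sides \<open>b\<close> and \<open>b'\<close>. In the first two cases \<open>m\<close> forms too narrow
a sector with one of them. Otherwise the direction opposite to \<open>m\<close> lies between \<open>b\<close> and
\<open>b'\<close>, and a direction \<open>v\<close> between them within \<open>A / 2\<close> of it does the same.\<close>
  consider "b' < m + pi" | "m + pi < b" | "b < m + pi" "m + pi \<le> b'" | "m + pi = b" by linarith
  then show False
  proof cases
    case 1
    then show ?thesis using gap[OF m(1) b'] m order b_def b'_def by linarith
  next
    case 2
    then show ?thesis using gap[OF b m2] m order by (simp add: b_def b'_def)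
  next
    case 3
    define v where "v = max b (m + pi - A / 2)"
    have v: "b \<le> v" "v \<le> b'" "m < v" "v < m + pi" "v - m > pi - A"
      using 3 order m t sec by (auto simp: v_def b_def b'_def A_def max_def)
    have "bounded_in_direction S v"
      using bounded_in_direction_between[OF b b' v(1,2)] order by simp
    from gap[OF m(1) this] v show ?thesis by simp
  next
    case 4
    define v where "v = min b' (b + A / 2)"
    have v: "b < v" "v \<le> b'" "v \<le> b + A / 2" using order by (auto simp: v_def)
    have "bounded_in_direction S v"
      using bounded_in_direction_between[OF b b' _ v(2)] v order by simp
    from gap[OF this m2] v 4 order show ?thesis by simp
  qed
qed

text \<open>An angle at infinity \<open>A\<close> forces a recession cone of opening at least \<open>A\<close>. The infimum need not be
attained, as for the region above the graph of \<open>\<bar>x\<bar> - sqrt (1 + \<bar>x\<bar>)\<close>, so \<open>S\<close> itself may lie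
in no sector of angle \<open>A\<close>. Sectors of angles tending to \<open>A\<close> are used instead, and the arc starts
at a limit of their directions.\<close>

lemma recession_arc:
  assumes "open S" "convex S" "0 < angle_at_infinity S" "angle_at_infinity S < pi"
  obtains a where "\<And>t p r. a < t \<Longrightarrow> t < a + angle_at_infinity S \<Longrightarrow> p \<in> S \<Longrightarrow> 0 \<le> r
      \<Longrightarrow> p + of_real r * cis t \<in> S"
proof (cases "S = UNIV")
  case True
  then show ?thesis using that by blast
next
  case False
  define A where "A = angle_at_infinity S"
  have "\<exists>\<theta> w a. A \<le> \<theta> \<and> \<theta> < A + (pi - A) / real (Suc n) \<and> S \<subseteq> sector w a \<theta> \<and> a \<in> {-pi..pi}" for n
  proof -
    have "angle_at_infinity S < A + (pi - A) / real (Suc n)"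
      using assms(4) by (simp add: A_def)
    from sector_contains_near_angle[OF assms(2) False this assms(1)]
    obtain \<theta> w a where "A \<le> \<theta>" "\<theta> < A + (pi - A) / real (Suc n)" "S \<subseteq> sector w a \<theta>" "- pi \<le> a" "a \<le> pi"
      unfolding A_def by metis
    then show ?thesis
      by (intro exI[of _ \<theta>] exI[of _ w] exI[of _ a]) (simp only: atLeastAtMost_iff)
  qed
  then obtain \<theta> w a where th: "\<And>n. A \<le> \<theta> n" "\<And>n. \<theta> n < A + (pi - A) / real (Suc n)"
      and sec: "\<And>n. S \<subseteq> sector (w n) (a n) (\<theta> n)" and a: "\<And>n::nat. a n \<in> {-pi..pi}"
    by metis
  have "compact {-pi..pi}" by simp
  then obtain l \<sigma> where \<sigma>: "strict_mono \<sigma>" "(a \<circ> \<sigma>) \<longlonglongrightarrow> l"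
    using a unfolding compact_def by (metis (no_types, lifting))
  have thlim: "\<theta> \<longlonglongrightarrow> A"
  proof (rule tendsto_sandwich[of "\<lambda>_. A" _ _ "\<lambda>n. A + (pi - A) / real (Suc n)"])
    show "(\<lambda>n. A + (pi - A) / real (Suc n)) \<longlonglongrightarrow> A" by real_asymp
    show "\<forall>\<^sub>F n in sequentially. \<theta> n \<le> A + (pi - A) / real (Suc n)"
      using th(2) by (intro always_eventually allI less_imp_le)
  qed (use th(1) in auto)
  then have thlim': "(\<theta> \<circ> \<sigma>) \<longlonglongrightarrow> A" by (rule LIMSEQ_subseq_LIMSEQ[OF _ \<sigma>(1)])
  show ?thesis
  proof (rule that[of l])
    fix t p r assume t: "l < t" "t < l + angle_at_infinity S" and p: "p \<in> S" "0 \<le> (r::real)"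
    have "(\<lambda>n. (a \<circ> \<sigma>) n + (\<theta> \<circ> \<sigma>) n - A) \<longlonglongrightarrow> l + A - A" "(\<lambda>n. (a \<circ> \<sigma>) n + A) \<longlonglongrightarrow> l + A"
      by (intro tendsto_intros \<sigma> thlim')+
    then have "\<forall>\<^sub>F n in sequentially. (a \<circ> \<sigma>) n + (\<theta> \<circ> \<sigma>) n - A < t"
        "\<forall>\<^sub>F n in sequentially. (a \<circ> \<sigma>) n + A > t" "\<forall>\<^sub>F n in sequentially. (\<theta> \<circ> \<sigma>) n < pi"
      using t assms(4) by (auto intro: order_tendstoD(1) order_tendstoD(2)[OF thlim', of pi, unfolded o_def]
          order_tendstoD(2) simp: A_def)
    then have "\<forall>\<^sub>F n in sequentially. p + of_real r * cis t \<in> S"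
    proof eventually_elim
      case (elim n)
      show ?case
        by (rule recession_direction_in_near_sector[OF assms(1-3) sec[of "\<sigma> n"]])
           (use elim p th in \<open>auto simp: A_def\<close>)
    qed
    then show "p + of_real r * cis t \<in> S" by simp
  qed
qed

section \<open>Self-maps of the disc and horocycles\<close>

text \<open>The identity behind the invariance of the pseudohyperbolic distance
\<open>cmod (a - b) / cmod (1 - cnj a * b)\<close>. It converts that distance into the quantity
\<open>(1 - (cmod a)\<^sup>2) * (1 - (cmod b)\<^sup>2) / (cmod (1 - cnj a * b))\<^sup>2\<close>, which, unlike the
distance, passes to the limit well when one of the points tends to the boundary.\<close>

lemma moebius_identity:
  fixes a b :: complex
  shows "(cmod (1 - cnj a * b))\<^sup>2 - (cmod (a - b))\<^sup>2 = (1 - (cmod a)\<^sup>2) * (1 - (cmod b)\<^sup>2)"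
  unfolding cmod_power2 by (simp add: power2_eq_square) algebra

lemma moebius_denominator_nonzero:
  fixes a b :: complex
  assumes "cmod a < 1" "cmod b \<le> 1"
  shows "1 - cnj a * b \<noteq> 0"
proof
  assume "1 - cnj a * b = 0"
  then have "cmod (cnj a * b) = 1" by simp
  moreover have "cmod (cnj a * b) \<le> cmod a * 1"
    unfolding norm_mult using assms by (intro mult_mono) auto
  ultimately show False using assms by simp
qed

lemma moebius_less_one:
  assumes "cmod a < 1" "cmod b < 1"
  shows "cmod ((b - a) / (1 - cnj a * b)) < 1"
proof -
  have "(1 - (cmod a)\<^sup>2) * (1 - (cmod b)\<^sup>2) > 0"
    using assms by (intro mult_pos_pos) (auto simp: abs_square_less_1)
  then have "(cmod (b - a))\<^sup>2 < (cmod (1 - cnj a * b))\<^sup>2"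
    using moebius_identity[of a b] by (simp add: norm_minus_commute)
  then have "cmod (b - a) < cmod (1 - cnj a * b)"
    by (rule power_less_imp_less_base) simp
  then show ?thesis
    using moebius_denominator_nonzero[of a b] assms by (simp add: norm_divide)
qed

text \<open>The Schwarz lemma applied after moving \<open>a\<close> and \<open>h a\<close> to the origin.\<close>

lemma Schwarz_Pick:
  assumes "h holomorphic_on ball 0 1" "h ` ball 0 1 \<subseteq> ball 0 1"
    and a: "cmod a < 1" and b: "cmod b < 1"
  shows "(1 - (cmod a)\<^sup>2) * (1 - (cmod b)\<^sup>2) * (cmod (1 - cnj (h a) * h b))\<^sup>2
      \<le> (1 - (cmod (h a))\<^sup>2) * (1 - (cmod (h b))\<^sup>2) * (cmod (1 - cnj a * b))\<^sup>2"
proof -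
  have h1: "cmod (h z) < 1" if "cmod z < 1" for z
    using assms(2) that by force
  define \<phi> where "\<phi> z = (z + a) / (1 + cnj a * z)" for z
  define \<psi> where "\<psi> z = (z - h a) / (1 - cnj (h a) * z)" for z
  have \<phi>1: "cmod (\<phi> z) < 1" if "cmod z < 1" for z
    using moebius_less_one[of "- a" z] that a by (simp add: \<phi>_def)
  have \<phi>nz: "1 + cnj a * z \<noteq> 0" if "cmod z < 1" for z
    using moebius_denominator_nonzero[of "- a" z] that a by simp
  have \<psi>nz: "1 - cnj (h a) * z \<noteq> 0" if "cmod z < 1" for z
    using moebius_denominator_nonzero[of "h a" z] that h1 a by simp
  have \<psi>1: "cmod (\<psi> z) < 1" if "cmod z < 1" for z
    using moebius_less_one[of "h a" z] that a h1 by (simp add: \<psi>_def)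
  have hol: "(\<lambda>z. \<psi> (h (\<phi> z))) holomorphic_on ball 0 1"
  proof -
    have 1: "\<phi> holomorphic_on ball 0 1" unfolding \<phi>_def
      by (intro holomorphic_intros) (use \<phi>nz in auto)
    have 2: "\<psi> holomorphic_on ball 0 1" unfolding \<psi>_def
      by (intro holomorphic_intros) (use \<psi>nz in auto)
    have 3: "(h \<circ> \<phi>) holomorphic_on ball 0 1"
      by (rule holomorphic_on_compose_gen[OF 1 assms(1)]) (use \<phi>1 in auto)
    have "(\<psi> \<circ> (h \<circ> \<phi>)) holomorphic_on ball 0 1"
      by (rule holomorphic_on_compose_gen[OF 3 2]) (use \<phi>1 h1 in auto)
    then show ?thesis by (simp add: o_def)
  qed
  define \<zeta> where "\<zeta> = (b - a) / (1 - cnj a * b)"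
  have \<zeta>: "cmod \<zeta> < 1" unfolding \<zeta>_def using moebius_less_one a b by blast
  have "\<phi> \<zeta> = b"
  proof -
    have 1: "1 - cnj a * b \<noteq> 0" "1 - cnj a * a \<noteq> 0"
      using moebius_denominator_nonzero a b less_imp_le by blast+
    then have "1 + cnj a * \<zeta> = (1 - cnj a * a) / (1 - cnj a * b)" "\<zeta> + a = b * (1 - cnj a * a) / (1 - cnj a * b)"
      by (simp_all add: \<zeta>_def field_simps)
    then show ?thesis using 1 by (simp add: \<phi>_def)
  qed
  moreover have "cmod (\<psi> (h (\<phi> \<zeta>))) \<le> cmod \<zeta>"
  proof (rule Schwarz_Lemma(1)[OF hol _ _ \<zeta>])
    show "\<psi> (h (\<phi> 0)) = 0" by (simp add: \<phi>_def \<psi>_def)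
  qed (use \<phi>1 \<psi>1 h1 in auto)
  ultimately have "cmod (\<psi> (h b)) \<le> cmod \<zeta>" by simp
  then have "cmod (h b - h a) / cmod (1 - cnj (h a) * h b) \<le> cmod (b - a) / cmod (1 - cnj a * b)"
    by (simp add: \<psi>_def \<zeta>_def norm_divide)
  then have "cmod (h b - h a) * cmod (1 - cnj a * b) \<le> cmod (b - a) * cmod (1 - cnj (h a) * h b)"
    using moebius_denominator_nonzero[of a b] moebius_denominator_nonzero[of "h a" "h b"] h1 a b
    by (simp add: field_simps less_imp_le)
  then have "(cmod (h a - h b) * cmod (1 - cnj a * b))\<^sup>2 \<le> (cmod (a - b) * cmod (1 - cnj (h a) * h b))\<^sup>2"
    by (intro power_mono) (auto simp: norm_minus_commute)
  then show ?thesis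
    unfolding power_mult_distrib moebius_identity[symmetric]
    by (simp only: left_diff_distrib) (simp only: mult.commute)
qed

text \<open>If the pseudohyperbolic distance of two points is at most \<open>s\<close>, then their Euclidean distance and
the ratio of their distances to the unit circle are controlled by \<open>s\<close>. For the ratio, with
\<open>x = 1 - (cmod a)\<^sup>2\<close> and \<open>y = 1 - (cmod b)\<^sup>2\<close>, one has \<open>cmod (1 - cnj a * b) \<ge> (x + y) / 2\<close>, so
the hypothesis gives \<open>1 - s\<^sup>2 \<le> 4 * x * y / (x + y)\<^sup>2\<close>.\<close>

lemma hyperbolically_close:
  assumes a: "cmod a < 1" and b: "cmod b < 1" and s: "0 \<le> s" "s < 1"
    and K: "(1 - s\<^sup>2) * (cmod (1 - cnj a * b))\<^sup>2 \<le> (1 - (cmod a)\<^sup>2) * (1 - (cmod b)\<^sup>2)"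
  shows "cmod (a - b) \<le> 2 * s"
    and "(1 - (cmod b)\<^sup>2) * (1 - s) \<le> (1 - (cmod a)\<^sup>2) * (1 + s)"
proof -
  have 1: "(cmod (a - b))\<^sup>2 \<le> s\<^sup>2 * (cmod (1 - cnj a * b))\<^sup>2"
    using K moebius_identity[of a b] by (simp add: algebra_simps)
  have "cmod (1 - cnj a * b) \<le> 1 + cmod a * cmod b"
    using norm_triangle_ineq4[of 1 "cnj a * b"] by (simp add: norm_mult)
  also have "\<dots> \<le> 2" using a b mult_mono[of "cmod a" 1 "cmod b" 1] by simp
  finally have "cmod (1 - cnj a * b) \<le> 2" .
  moreover have "cmod (a - b) \<le> s * cmod (1 - cnj a * b)"
    using 1 s by (intro power2_le_imp_le[of "cmod (a - b)"]) (auto simp: power_mult_distrib)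
  ultimately show "cmod (a - b) \<le> 2 * s"
    using s mult_left_mono[of "cmod (1 - cnj a * b)" 2 s] by linarith
  define x y where "x = 1 - (cmod a)\<^sup>2" and "y = 1 - (cmod b)\<^sup>2"
  have x: "x > 0" and y: "y > 0" using a b by (auto simp: x_def y_def abs_square_less_1)
  have "cmod (1 - cnj a * b) \<ge> 1 - cmod a * cmod b"
    using norm_triangle_ineq2[of 1 "cnj a * b"] by (simp add: norm_mult)
  moreover have "1 - cmod a * cmod b \<ge> (x + y) / 2"
    using sum_squares_bound[of "cmod a" "cmod b"] by (simp add: x_def y_def)
  ultimately have "((x + y) / 2)\<^sup>2 \<le> (cmod (1 - cnj a * b))\<^sup>2"
    using x y by (intro power_mono) auto
  then have "(1 - s\<^sup>2) * ((x + y) / 2)\<^sup>2 \<le> (1 - s\<^sup>2) * (cmod (1 - cnj a * b))\<^sup>2"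
    using s by (intro mult_left_mono) (auto simp: abs_square_le_1)
  also have "\<dots> \<le> x * y" using K by (simp add: x_def y_def)
  finally have "(y - x)\<^sup>2 \<le> (s * (x + y))\<^sup>2"
  proof -
    assume *: "(1 - s\<^sup>2) * ((x + y) / 2)\<^sup>2 \<le> x * y"
    have 1: "(y - x)\<^sup>2 = (x + y)\<^sup>2 - 4 * (x * y)"
      by (simp add: power2_eq_square algebra_simps)
    have "(1 - s\<^sup>2) * (x + y)\<^sup>2 \<le> 4 * (x * y)"
      using * by (simp add: power_divide)
    then show ?thesis
      unfolding 1 power_mult_distrib left_diff_distrib by simp
  qed
  moreover have "0 \<le> s * (x + y)" using x y s by simp
  ultimately have "y - x \<le> s * (x + y)"
    by (rule power2_le_imp_le)
  then show "y * (1 - s) \<le> x * (1 + s)" by (simp add: algebra_simps)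
qed

text \<open>A version of Julia's lemma. If \<open>h\<close> moves points \<open>a n\<close> that converge to a boundary point \<open>\<xi>\<close>
by hyperbolic distances tending to \<open>0\<close>, then \<open>h\<close> maps every horodisc at \<open>\<xi>\<close> into itself:
apply the Schwarz-Pick inequality to \<open>z\<close> and \<open>a n\<close>, replace \<open>1 - (cmod (h (a n)))\<^sup>2\<close> by
\<open>1 - (cmod (a n))\<^sup>2\<close> at the cost of a factor tending to \<open>1\<close>, cancel, and let \<open>n\<close> tend to
infinity. The approach of \<open>a n\<close> to \<open>\<xi>\<close> may be tangential.\<close>

lemma horocycle_invariance:
  assumes h: "h holomorphic_on ball 0 1" "h ` ball 0 1 \<subseteq> ball 0 1"
    and a: "\<And>n. cmod (a n) < 1" "a \<longlonglongrightarrow> \<xi>" and s: "\<And>n. 0 \<le> s n" "s \<longlonglongrightarrow> 0"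
    and K: "\<forall>\<^sub>F n in sequentially. (1 - (s n)\<^sup>2) * (cmod (1 - cnj (a n) * h (a n)))\<^sup>2
           \<le> (1 - (cmod (a n))\<^sup>2) * (1 - (cmod (h (a n)))\<^sup>2)"
    and z: "cmod z < 1"
  shows "(1 - (cmod z)\<^sup>2) * (cmod (1 - cnj (h z) * \<xi>))\<^sup>2 \<le> (1 - (cmod (h z))\<^sup>2) * (cmod (1 - cnj z * \<xi>))\<^sup>2"
proof -
  have h1: "cmod (h z) < 1" if "cmod z < 1" for z
    using h(2) that by force
  have ev: "\<forall>\<^sub>F n in sequentially. s n < 1"
    using s(2) by (rule order_tendstoD) simp
  have close: "\<forall>\<^sub>F n in sequentially. cmod (a n - h (a n)) \<le> 2 * s n \<and> 
     (1 - (cmod (h (a n)))\<^sup>2) * (1 - s n) \<le> (1 - (cmod (a n))\<^sup>2) * (1 + s n)"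
    using ev K
  proof eventually_elim
    case (elim n)
    show ?case using hyperbolically_close[OF a(1) h1[OF a(1)] s(1) elim] by blast
  qed
  have "(\<lambda>n. a n - h (a n)) \<longlonglongrightarrow> 0"
  proof (rule Lim_null_comparison)
    show "\<forall>\<^sub>F n in sequentially. norm (a n - h (a n)) \<le> 2 * s n"
      using close by eventually_elim simp
    show "(\<lambda>n. 2 * s n) \<longlonglongrightarrow> 0" using tendsto_mult_left[OF s(2), of 2] by simp
  qed
  from tendsto_diff[OF a(2) this] have ha: "(\<lambda>n. h (a n)) \<longlonglongrightarrow> \<xi>" by simp
  have 1: "\<forall>\<^sub>F n in sequentially. (1 - (cmod z)\<^sup>2) * (cmod (1 - cnj (h z) * h (a n)))\<^sup>2 * (1 - s n)
      \<le> (1 - (cmod (h z))\<^sup>2) * (cmod (1 - cnj z * a n))\<^sup>2 * (1 + s n)"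
    using close ev
  proof eventually_elim
    case (elim n)
    define x y where "x = 1 - (cmod (a n))\<^sup>2" and "y = 1 - (cmod (h (a n)))\<^sup>2"
    have x: "x > 0" using a(1)[of n] by (auto simp: x_def abs_square_less_1)
    define P Q where "P = (1 - (cmod z)\<^sup>2) * (cmod (1 - cnj (h z) * h (a n)))\<^sup>2"
      and "Q = (1 - (cmod (h z))\<^sup>2) * (cmod (1 - cnj z * a n))\<^sup>2"
    have Q: "Q \<ge> 0" using h1[OF z] by (auto simp: Q_def abs_square_le_1)
    have "P * x \<le> Q * y"
      using Schwarz_Pick[OF h z a(1)[of n]] by (simp add: P_def Q_def x_def y_def algebra_simps)
    then have "P * x * (1 - s n) \<le> Q * y * (1 - s n)"
      using elim by (intro mult_right_mono) auto
    also have "\<dots> \<le> Q * (x * (1 + s n))"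
      using elim Q unfolding mult.assoc by (intro mult_left_mono) (auto simp: x_def y_def)
    finally have "x * (P * (1 - s n)) \<le> x * (Q * (1 + s n))" by (simp add: algebra_simps)
    then have "P * (1 - s n) \<le> Q * (1 + s n)" using x by simp
    then show ?case by (simp add: P_def Q_def)
  qed
  have 2: "(\<lambda>n. (1 - (cmod z)\<^sup>2) * (cmod (1 - cnj (h z) * h (a n)))\<^sup>2 * (1 - s n))
      \<longlonglongrightarrow> (1 - (cmod z)\<^sup>2) * (cmod (1 - cnj (h z) * \<xi>))\<^sup>2 * (1 - 0)"
    by (intro tendsto_intros ha s)
  have 3: "(\<lambda>n. (1 - (cmod (h z))\<^sup>2) * (cmod (1 - cnj z * a n))\<^sup>2 * (1 + s n))
      \<longlonglongrightarrow> (1 - (cmod (h z))\<^sup>2) * (cmod (1 - cnj z * \<xi>))\<^sup>2 * (1 + 0)"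
    by (intro tendsto_intros a s)
  show ?thesis
    using tendsto_le[OF sequentially_bot 3 2 1] by simp
qed

text \<open>The map \<open>z \<mapsto> (\<xi> + z) / (\<xi> - z)\<close> sends the disc to the right half-plane and \<open>\<xi>\<close> to
infinity; the level sets of its real part are the horocycles at \<open>\<xi>\<close>.\<close>

lemma Re_Cayley:
  assumes "cmod \<xi> = 1"
  shows "Re ((\<xi> + z) / (\<xi> - z)) = (1 - (cmod z)\<^sup>2) / (cmod (1 - cnj z * \<xi>))\<^sup>2"
proof -
  have "cmod (1 - cnj z * \<xi>) = cmod (\<xi> - z)"
  proof -
    have "(cmod (1 - cnj z * \<xi>))\<^sup>2 - (cmod (z - \<xi>))\<^sup>2 = 0"
      using moebius_identity[of z \<xi>] assms by simp
    then show ?thesis by (simp add: norm_minus_commute)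
  qed
  moreover have "Re ((\<xi> + z) / (\<xi> - z)) = Re ((\<xi> + z) * cnj (\<xi> - z)) / (cmod (\<xi> - z))\<^sup>2"
    unfolding complex_div_cnj[of "\<xi> + z"] of_real_power[symmetric] Re_divide_of_real ..
  moreover have "Re ((\<xi> + z) * cnj (\<xi> - z)) = (cmod \<xi>)\<^sup>2 - (cmod z)\<^sup>2"
    unfolding cmod_power2 by (simp add: power2_eq_square algebra_simps)
  ultimately show ?thesis using assms by simp
qed

text \<open>Translation by \<open>d\<close> maps the range of \<open>g\<close> into itself, and hence induces a self-map of the disc. The
range contains balls of radii \<open>R n\<close> tending to infinity, so at their centres a shift by \<open>d\<close> is a
hyperbolically short move, of length about \<open>cmod d / R n\<close>. If the preimages of the centres converge
to \<open>\<xi>\<close>, horodiscs at \<open>\<xi>\<close> are therefore preserved, which means that the half-plane coordinate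
with \<open>\<xi>\<close> at infinity has increasing real part.\<close>

lemma translation_increases_Re:
  assumes g: "g holomorphic_on ball 0 1"
    and G: "G holomorphic_on g ` ball 0 1" "\<And>z. z \<in> ball 0 1 \<Longrightarrow> G (g z) = z"
    and d: "\<And>p. p \<in> g ` ball 0 1 \<Longrightarrow> p + d \<in> g ` ball 0 1"
    and R: "filterlim R at_top sequentially" "\<And>n. ball (p n) (R n) \<subseteq> g ` ball 0 1" "\<And>n. p n \<in> g ` ball 0 1"
    and \<xi>: "(\<lambda>n. G (p n)) \<longlonglongrightarrow> \<xi>" "cmod \<xi> = 1"
    and z: "z \<in> ball 0 1"
  shows "Re ((\<xi> + z) / (\<xi> - z)) \<le> Re ((\<xi> + G (g z + d)) / (\<xi> - G (g z + d)))"
proof -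
  have G1: "G w \<in> ball 0 1" "g (G w) = w" if "w \<in> g ` ball 0 1" for w
    using that G(2) by auto
  define h where "h z = G (g z + d)" for z
  have "(G \<circ> (\<lambda>z. g z + d)) holomorphic_on ball 0 1"
    by (rule holomorphic_on_compose_gen[OF _ G(1)]) (use g d in \<open>auto intro!: holomorphic_intros\<close>)
  then have hh: "h holomorphic_on ball 0 1" by (simp add: h_def[abs_def] o_def)
  have hb: "h ` ball 0 1 \<subseteq> ball 0 1" using G1 d by (auto simp: h_def)
  define s where "s n = cmod d / R n" for n
  have s0: "s \<longlonglongrightarrow> 0" unfolding s_def
    by (rule tendsto_divide_0[OF tendsto_const filterlim_at_top_imp_at_infinity[OF R(1)]])
  have evR: "\<forall>\<^sub>F n in sequentially. R n > cmod d" 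
    using R(1) by (auto simp: filterlim_at_top_dense)
  have K: "\<forall>\<^sub>F n in sequentially. (1 - (\<bar>s n\<bar>)\<^sup>2) * (cmod (1 - cnj (G (p n)) * h (G (p n))))\<^sup>2
           \<le> (1 - (cmod (G (p n)))\<^sup>2) * (1 - (cmod (h (G (p n))))\<^sup>2)"
    using evR
  proof eventually_elim
    case (elim n)
    then have Rp: "R n > 0" using norm_ge_zero[of d] by linarith
    \<comment> \<open>The Schwarz-Pick inequality for this rescaled ball bounds the hyperbolic length of the shift.\<close>
    define u where "u \<zeta> = G (p n + of_real (R n) * \<zeta>)" for \<zeta>
    have sub: "p n + of_real (R n) * \<zeta> \<in> g ` ball 0 1" if "\<zeta> \<in> ball 0 1" for \<zeta>
      using that Rp by (intro subsetD[OF R(2)[of n]]) (auto simp: dist_norm norm_mult)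
    have "(G \<circ> (\<lambda>\<zeta>. p n + of_real (R n) * \<zeta>)) holomorphic_on ball 0 1"
      by (rule holomorphic_on_compose_gen[OF _ G(1)]) (use sub in \<open>auto intro!: holomorphic_intros\<close>)
    then have uh: "u holomorphic_on ball 0 1" by (simp add: u_def[abs_def] o_def)
    have ub: "u ` ball 0 1 \<subseteq> ball 0 1" using G1(1) sub unfolding u_def by blast
    define \<sigma> where "\<sigma> = d / of_real (R n)"
    have \<sigma>: "cmod \<sigma> = s n" "cmod \<sigma> < 1"
      using elim Rp by (auto simp: \<sigma>_def s_def norm_divide)
    have "u \<sigma> = h (G (p n))" 
      using Rp G1(2)[OF R(3)] by (simp add: u_def \<sigma>_def h_def)
    moreover have "u 0 = G (p n)" by (simp add: u_def)
    ultimately show ?case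
      using Schwarz_Pick[OF uh ub, of 0 \<sigma>] \<sigma> by simp
  qed
  have z1: "cmod z < 1" using z by simp
  have hz: "cmod (h z) < 1" using hb z by force
  have "(1 - (cmod z)\<^sup>2) * (cmod (1 - cnj (h z) * \<xi>))\<^sup>2 \<le> (1 - (cmod (h z))\<^sup>2) * (cmod (1 - cnj z * \<xi>))\<^sup>2"
  proof (rule horocycle_invariance[OF hh hb, of "\<lambda>n. G (p n)" \<xi> "\<lambda>n. \<bar>s n\<bar>"])
    show "cmod (G (p n)) < 1" for n using G1(1)[OF R(3)] by simp
    show "(\<lambda>n. \<bar>s n\<bar>) \<longlonglongrightarrow> 0" using s0 by (rule tendsto_rabs_zero)
  qed (use \<xi> K z1 in auto)
  moreover have "1 - cnj z * \<xi> \<noteq> 0" "1 - cnj (h z) * \<xi> \<noteq> 0"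
    using moebius_denominator_nonzero \<xi> z1 hz by auto
  ultimately have "Re ((\<xi> + z) / (\<xi> - z)) \<le> Re ((\<xi> + h z) / (\<xi> - h z))"
    unfolding Re_Cayley[OF \<xi>(2)] by (simp add: field_simps)
  then show ?thesis by (simp add: h_def)
qed

section \<open>Estimates in the right half-plane\<close>

abbreviation right_half_plane :: "complex set" where
  "right_half_plane \<equiv> {w. 0 < Re w}"

lemma cmod_add_one_sq: "(cmod (w + 1))\<^sup>2 = (cmod (w - 1))\<^sup>2 + 4 * Re w"
  unfolding cmod_power2 by (simp add: power2_eq_square algebra_simps)

lemma Cayley_in_disc:
  assumes "0 < Re w"
  shows "cmod ((w - 1) / (w + 1)) < 1" "1 - cmod ((w - 1) / (w + 1)) \<ge> 2 * Re w / (cmod (w + 1))\<^sup>2"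
proof -
  have nz: "w + 1 \<noteq> 0" using assms by (auto simp: complex_eq_iff)
  define r where "r = cmod ((w - 1) / (w + 1))"
  have r2: "1 - r\<^sup>2 = 4 * Re w / (cmod (w + 1))\<^sup>2"
  proof -
    have "(cmod (w + 1))\<^sup>2 \<noteq> 0" using nz by simp
    moreover have "r\<^sup>2 = ((cmod (w + 1))\<^sup>2 - 4 * Re w) / (cmod (w + 1))\<^sup>2"
      by (simp only: r_def norm_divide power_divide cmod_add_one_sq add_diff_cancel_right')
    ultimately show ?thesis by (simp add: diff_divide_distrib)
  qed
  moreover have "0 < 4 * Re w / (cmod (w + 1))\<^sup>2" using assms nz by simp
  ultimately have "r\<^sup>2 < 1" by linarith
  then show r1: "cmod ((w - 1) / (w + 1)) < 1" 
    unfolding r_def[symmetric] by (simp add: abs_square_less_1 r_def)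
  have "1 - r\<^sup>2 = (1 - r) * (1 + r)" by (simp add: power2_eq_square algebra_simps)
  also have "\<dots> \<le> (1 - r) * 2"
    using r1 by (intro mult_left_mono) (auto simp: r_def)
  finally show "1 - cmod ((w - 1) / (w + 1)) \<ge> 2 * Re w / (cmod (w + 1))\<^sup>2"
    using r2 by (simp add: r_def)
qed

text \<open>A Harnack-type bound, obtained from the Schwarz lemma in the disc. The factor
\<open>(cmod (w + 1))\<^sup>2 / Re w\<close> is four times the reciprocal of \<open>1 - (cmod z)\<^sup>2\<close> at the point
\<open>z = (w - 1) / (w + 1)\<close> of the disc.\<close>

lemma positive_real_part_bound:
  assumes hol: "Q holomorphic_on right_half_plane" and pos: "\<And>w. 0 < Re w \<Longrightarrow> 0 \<le> Re (Q w)"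
  obtains C where "0 < C" "\<And>w. 0 < Re w \<Longrightarrow> cmod (Q w) \<le> C * ((cmod (w + 1))\<^sup>2 / Re w)"
proof -
  define T :: "complex \<Rightarrow> complex" where "T z = (1 + z) / (1 - z)" for z
  have T: "0 < Re (T z)" if "cmod z < 1" for z
  proof -
    have "z \<noteq> 1" using that by auto
    have "Re (T z) = Re ((1 + z) * cnj (1 - z)) / (cmod (1 - z))\<^sup>2"
      unfolding T_def complex_div_cnj[of "1 + z"] of_real_power[symmetric] Re_divide_of_real ..
    also have "Re ((1 + z) * cnj (1 - z)) = 1 - (cmod z)\<^sup>2"
      unfolding cmod_power2 by (simp add: power2_eq_square algebra_simps)
    finally show ?thesis using that \<open>z \<noteq> 1\<close> by (simp add: abs_square_less_1)
  qed
  have Thol: "T holomorphic_on ball 0 1"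
    unfolding T_def by (intro holomorphic_intros) auto
  \<comment> \<open>Adding \<open>1\<close> makes the real part strictly positive, so that the Cayley transform \<open>M\<close> maps into the open disc.\<close>
  define P where "P z = Q (T z) + 1" for z
  have "(Q \<circ> T) holomorphic_on ball 0 1"
    by (rule holomorphic_on_compose_gen[OF Thol hol]) (use T in auto)
  then have Phol: "P holomorphic_on ball 0 1"
    unfolding P_def by (auto intro!: holomorphic_intros simp: o_def)
  have Pre: "1 \<le> Re (P z)" if "cmod z < 1" for z
    using pos[OF T[OF that]] by (simp add: P_def)
  define M where "M z = (P z - P 0) / (P z + cnj (P 0))" for z
  have Mnz: "P z + cnj (P 0) \<noteq> 0" if "cmod z < 1" for z
  proof
    assume "P z + cnj (P 0) = 0"
    then have "Re (P z + cnj (P 0)) = 0" by simp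
    with Pre[OF that] Pre[of 0] show False by simp
  qed
  have Mhol: "M holomorphic_on ball 0 1"
    unfolding M_def by (intro holomorphic_intros Phol) (use Mnz in auto)
  have M1: "cmod (M z) < 1" if "cmod z < 1" for z
  proof -
    have "(cmod (P z + cnj (P 0)))\<^sup>2 - (cmod (P z - P 0))\<^sup>2 = 4 * Re (P z) * Re (P 0)"
      unfolding cmod_power2 by (simp add: power2_eq_square algebra_simps)
    moreover have "4 * Re (P z) * Re (P 0) > 0" using Pre[OF that] Pre[of 0] by simp
    ultimately have "(cmod (P z - P 0))\<^sup>2 < (cmod (P z + cnj (P 0)))\<^sup>2" by linarith
    then have "cmod (P z - P 0) < cmod (P z + cnj (P 0))"
      by (rule power_less_imp_less_base) simp
    then show ?thesis using Mnz[OF that] by (simp add: M_def norm_divide)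
  qed
  have bound: "cmod (P z) * (1 - cmod z) \<le> 2 * cmod (P 0)" if "cmod z < 1" for z
  proof -
    have "cmod (M z) \<le> cmod z"
      by (rule Schwarz_Lemma(1)[OF Mhol _ M1 that]) (simp add: M_def)
    then have "cmod (P z - P 0) \<le> cmod z * cmod (P z + cnj (P 0))"
      using Mnz[OF that] by (simp add: M_def norm_divide field_simps)
    also have "\<dots> \<le> cmod z * (cmod (P z) + cmod (P 0))"
      using norm_triangle_ineq[of "P z" "cnj (P 0)"] by (intro mult_left_mono) auto
    finally have "cmod (P z - P 0) \<le> cmod z * cmod (P z) + cmod z * cmod (P 0)"
      by (simp add: algebra_simps)
    moreover have "cmod z * cmod (P 0) \<le> 1 * cmod (P 0)"
      using that by (intro mult_right_mono) auto
    ultimately show ?thesis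
      using norm_triangle_ineq2[of "P z" "P 0"] by (simp add: algebra_simps)
  qed
  show ?thesis
  proof
    show "0 < cmod (P 0) + 1" using norm_ge_zero[of "P 0"] by linarith
    fix w assume w: "0 < Re w"
    then have nz: "w + 1 \<noteq> 0" by (auto simp: complex_eq_iff)
    define z where "z = (w - 1) / (w + 1)"
    define X where "X = (cmod (w + 1))\<^sup>2 / Re w"
    have X: "X > 0" using w nz by (simp add: X_def)
    have X1: "X \<ge> 1"
      using cmod_add_one_sq[of w] w zero_le_power2[of "cmod (w - 1)"] by (simp add: X_def field_simps)
    have z: "cmod z < 1" "1 - cmod z \<ge> 2 / X"
      using Cayley_in_disc[OF w] by (simp_all add: z_def X_def)
    have "1 + z = 2 * w / (w + 1)" "1 - z = 2 / (w + 1)"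
      using nz by (simp_all add: z_def field_simps)
    then have "T z = w" using nz by (simp add: T_def)
    have "cmod (P z) * (2 / X) \<le> cmod (P z) * (1 - cmod z)"
      using z by (intro mult_left_mono) auto
    also have "\<dots> \<le> 2 * cmod (P 0)" by (rule bound[OF z(1)])
    finally have "cmod (P z) \<le> cmod (P 0) * X"
      using X by (simp add: field_simps)
    moreover have "cmod (Q w) \<le> cmod (P z) + 1"
      using norm_triangle_ineq4[of "P z" 1] by (simp add: P_def \<open>T z = w\<close>)
    ultimately show "cmod (Q w) \<le> (cmod (P 0) + 1) * ((cmod (w + 1))\<^sup>2 / Re w)"
      using X1 unfolding X_def[symmetric] by (simp add: algebra_simps)
  qed
qed

lemma abs_angle_le_of_rotations:
  fixes \<phi> b :: real
  assumes "- pi < \<phi>" "\<phi> \<le> pi" "0 < b" and rot: "\<And>s. \<bar>s\<bar> < b \<Longrightarrow> 0 \<le> cos (\<phi> + s)"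
  shows "\<bar>\<phi>\<bar> \<le> pi / 2 - b"
proof (rule ccontr)
  assume neg: "\<not> ?thesis"
  have rot': "0 \<le> cos (\<bar>\<phi>\<bar> + s)" if "\<bar>s\<bar> < b" for s
    using rot[of s] rot[of "- s"] that cos_minus[of "\<phi> - s"] by (cases "\<phi> \<ge> 0") (auto simp: algebra_simps)
  obtain s where s: "\<bar>s\<bar> < b" "pi / 2 < \<bar>\<phi>\<bar> + s" "\<bar>\<phi>\<bar> + s \<le> pi"
  proof (cases "\<bar>\<phi>\<bar> > pi / 2")
    case True
    then show ?thesis using that[of 0] assms by auto
  next
    case False
    define s where "s = (pi / 2 - \<bar>\<phi>\<bar>) + min ((b - (pi / 2 - \<bar>\<phi>\<bar>)) / 2) (pi / 2)"
    show ?thesis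
      using False neg by (intro that[of s]) (auto simp: s_def min_def field_simps)
  qed
  have "cos (\<bar>\<phi>\<bar> + s) < cos (pi / 2)"
    using s by (intro cos_monotone_0_pi) auto
  with rot'[OF s(1)] show False by simp
qed

text \<open>The hypothesis on rotations confines \<open>f\<close> to the sector of half-angle \<open>(1 - \<alpha>) * pi / 2\<close> about
the positive axis. Hence \<open>f\<close> to the power \<open>1 / (1 - \<alpha>)\<close>, here \<open>exp (L w)\<close>, has nonnegative real part, and so has its
reciprocal. The bounds above and below on \<open>f\<close> are Harnack-type bounds for these two functions.
The exponent \<open>1 - \<alpha>\<close> is the source of the exponent in the growth estimate.\<close>

lemma narrow_range_estimates:
  assumes \<alpha>: "0 < \<alpha>" "\<alpha> < 1" and hol: "f holomorphic_on right_half_plane" 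
    and nz: "\<And>w. 0 < Re w \<Longrightarrow> f w \<noteq> 0"
    and rot: "\<And>w s. 0 < Re w \<Longrightarrow> \<bar>s\<bar> < pi * \<alpha> / 2 \<Longrightarrow> 0 \<le> Re (cis s * f w)"
  shows "\<And>w. 0 < Re w \<Longrightarrow> sin (pi * \<alpha> / 2) * cmod (f w) \<le> Re (f w)"
    and "\<exists>c>0. \<forall>w. 0 < Re w \<longrightarrow> c * (Re w / (cmod (w + 1))\<^sup>2) powr (1 - \<alpha>) \<le> cmod (f w)"
    and "\<exists>C>0. \<forall>w. 0 < Re w \<longrightarrow> cmod (f w) \<le> C * ((cmod (w + 1))\<^sup>2 / Re w) powr (1 - \<alpha>)"
proof -
  have arg: "\<bar>Arg (f w)\<bar> \<le> pi / 2 - pi * \<alpha> / 2" if w: "0 < Re w" for w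
  proof (rule abs_angle_le_of_rotations)
    fix s assume "\<bar>s\<bar> < pi * \<alpha> / 2"
    from rot[OF w this] have "0 \<le> Re (cis s * rcis (cmod (f w)) (Arg (f w)))"
      by (simp only: rcis_cmod_Arg)
    also have "\<dots> = cmod (f w) * cos (Arg (f w) + s)"
      by (simp add: rcis_def cos_add algebra_simps)
    finally show "0 \<le> cos (Arg (f w) + s)"
      using nz[OF w] by (simp add: zero_le_mult_iff)
  qed (use \<alpha> Arg_le_pi mpi_less_Arg in auto)
  have cone: "sin (pi * \<alpha> / 2) * cmod (f w) \<le> Re (f w)" if w: "0 < Re w" for w
  proof -
    have "sin (pi * \<alpha> / 2) = cos (pi / 2 - pi * \<alpha> / 2)" by (simp add: cos_diff)
    also have "\<dots> \<le> cos \<bar>Arg (f w)\<bar>"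
      using arg[OF w] \<alpha> by (intro cos_monotone_0_pi_le) (auto intro: order_trans[of _ "pi / 2"])
    also have "\<dots> = cos (Arg (f w))" by (simp add: abs_if)
    finally have "sin (pi * \<alpha> / 2) * cmod (f w) \<le> cos (Arg (f w)) * cmod (f w)"
      by (intro mult_right_mono) auto
    also have "\<dots> = Re (rcis (cmod (f w)) (Arg (f w)))" by (simp add: rcis_def)
    finally show ?thesis by (simp only: rcis_cmod_Arg)
  qed
  have sinpos: "0 < sin (pi * \<alpha> / 2)"
  proof (rule sin_gt_zero)
    have "pi * \<alpha> < pi * 1" using \<alpha> by (intro mult_strict_left_mono) auto
    then show "pi * \<alpha> / 2 < pi" using pi_gt_zero by linarith
  qed (use \<alpha> in simp)
  have Repos: "0 < Re (f w)" if "0 < Re w" for w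
    using less_le_trans[OF mult_pos_pos[OF sinpos] cone[OF that]] nz[OF that] by simp
  define L where "L w = Ln (f w) / of_real (1 - \<alpha>)" for w
  have Lhol: "L holomorphic_on right_half_plane"
    unfolding L_def using \<alpha> Repos
    by (intro holomorphic_intros hol) (force simp: complex_nonpos_Reals_iff)+
  have ImL: "\<bar>Im (L w)\<bar> \<le> pi / 2" if w: "0 < Re w" for w
  proof -
    have "\<bar>Arg (f w)\<bar> \<le> (pi / 2) * (1 - \<alpha>)" using arg[OF w] by (simp add: algebra_simps)
    moreover have "Im (L w) = Arg (f w) / (1 - \<alpha>)"
      unfolding L_def Im_divide_of_real by (simp add: Arg_eq_Im_Ln nz[OF w])
    ultimately show ?thesis using \<alpha> by (simp add: abs_divide pos_divide_le_eq)
  qed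
  have ReL: "Re (L w) = ln (cmod (f w)) / (1 - \<alpha>)" if w: "0 < Re w" for w
    unfolding L_def Re_divide_of_real by (simp add: nz[OF w])
  have f_eq: "cmod (f w) = exp (Re (L w)) powr (1 - \<alpha>)" if w: "0 < Re w" for w
    using ReL[OF w] nz[OF w] \<alpha> by (simp add: powr_def)
  have pos: "0 \<le> Re (exp (L w))" "0 \<le> Re (exp (- L w))" if "0 < Re w" for w
    using ImL[OF that] cos_ge_zero[of "Im (L w)"] by (simp_all add: Re_exp abs_le_iff)
  have hols: "(\<lambda>w. exp (L w)) holomorphic_on right_half_plane" "(\<lambda>w. exp (- L w)) holomorphic_on right_half_plane"
    by (intro holomorphic_intros Lhol)+
  show "\<And>w. 0 < Re w \<Longrightarrow> sin (pi * \<alpha> / 2) * cmod (f w) \<le> Re (f w)" by (rule cone)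
  obtain C where C: "0 < C" "\<And>w. 0 < Re w \<Longrightarrow> cmod (exp (L w)) \<le> C * ((cmod (w + 1))\<^sup>2 / Re w)"
    using positive_real_part_bound[OF hols(1) pos(1)] by blast
  have "cmod (f w) \<le> C powr (1 - \<alpha>) * ((cmod (w + 1))\<^sup>2 / Re w) powr (1 - \<alpha>)" if w: "0 < Re w" for w
  proof -
    have "cmod (f w) \<le> (C * ((cmod (w + 1))\<^sup>2 / Re w)) powr (1 - \<alpha>)"
      unfolding f_eq[OF w] using C(2)[OF w] \<alpha> by (intro powr_mono2) (auto simp: norm_exp_eq_Re)
    then show ?thesis using C(1) w by (simp only: powr_mult)
  qed
  with C(1) show "\<exists>C>0. \<forall>w. 0 < Re w \<longrightarrow> cmod (f w) \<le> C * ((cmod (w + 1))\<^sup>2 / Re w) powr (1 - \<alpha>)"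
    by (intro exI[of _ "C powr (1 - \<alpha>)"]) simp
  obtain D where D: "0 < D" "\<And>w. 0 < Re w \<Longrightarrow> cmod (exp (- L w)) \<le> D * ((cmod (w + 1))\<^sup>2 / Re w)"
    using positive_real_part_bound[OF hols(2) pos(2)] by blast
  have "(1 / D) powr (1 - \<alpha>) * (Re w / (cmod (w + 1))\<^sup>2) powr (1 - \<alpha>) \<le> cmod (f w)" if w: "0 < Re w" for w
  proof -
    have nz1: "w + 1 \<noteq> 0" using w by (auto simp: complex_eq_iff)
    have "1 / exp (Re (L w)) \<le> D * ((cmod (w + 1))\<^sup>2 / Re w)"
      using D(2)[OF w] unfolding norm_exp_eq_Re uminus_complex.sel by (simp only: exp_minus inverse_eq_divide)
    then have "1 / D * (Re w / (cmod (w + 1))\<^sup>2) \<le> exp (Re (L w))"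
      using D(1) w nz1 by (simp add: field_simps)
    then have "(1 / D * (Re w / (cmod (w + 1))\<^sup>2)) powr (1 - \<alpha>) \<le> cmod (f w)"
      unfolding f_eq[OF w] using \<alpha> D(1) w by (intro powr_mono2) auto
    then show ?thesis using D(1) w by (simp only: powr_mult)
  qed
  with D(1) show "\<exists>c>0. \<forall>w. 0 < Re w \<longrightarrow> c * (Re w / (cmod (w + 1))\<^sup>2) powr (1 - \<alpha>) \<le> cmod (f w)"
    by (intro exI[of _ "(1 / D) powr (1 - \<alpha>)"]) simp
qed

text \<open>The derivative is at most a constant times \<open>x powr (\<alpha> - 1)\<close> along the horizontal segment ending at
the boundary point \<open>\<i> * \<eta>\<close>, and this is integrable at \<open>0\<close> because \<open>\<alpha> > 0\<close>.\<close>

lemma bounded_near_boundary_point: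
  assumes \<alpha>: "0 < \<alpha>" "\<alpha> < 1" and hol: "F holomorphic_on right_half_plane"
    and C: "0 < C" "\<And>w. 0 < Re w \<Longrightarrow> cmod (deriv F w) \<le> C * ((cmod (w + 1))\<^sup>2 / Re w) powr (1 - \<alpha>)"
  obtains M where "\<And>x. 0 < x \<Longrightarrow> x < 1 \<Longrightarrow> cmod (F (Complex x \<eta>)) \<le> M"
proof -
  define K where "K = C * (4 + \<eta>\<^sup>2) powr (1 - \<alpha>)"
  have "cmod (F (Complex x \<eta>)) \<le> cmod (F (Complex 1 \<eta>)) + K / \<alpha>" if x: "0 < x" "x < 1" for x
  proof -
    have dF: "((\<lambda>t. F (Complex t \<eta>)) has_vector_derivative deriv F (Complex t \<eta>)) (at t)" if "0 < t" for t
    proof -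
      have "(F has_field_derivative deriv F (Complex t \<eta>)) (at (Complex t \<eta>))"
        by (rule holomorphic_derivI[OF hol open_halfspace_Re_gt]) (use that in simp)
      moreover have "((\<lambda>t. Complex t \<eta>) has_vector_derivative 1) (at t)"
        using has_vector_derivative_complex_iff[of "\<lambda>t. Complex t \<eta>" 1 "at t"] by (simp add: has_vector_derivative_def)
      ultimately show ?thesis
        using field_vector_diff_chain_at[of "\<lambda>t. Complex t \<eta>" 1 t F] by (simp add: o_def)
    qed
    have "cmod (F (Complex 1 \<eta>) - F (Complex x \<eta>)) \<le> K / \<alpha> * 1 powr \<alpha> - K / \<alpha> * x powr \<alpha>"
    proof (rule differentiable_bound_general[where \<phi> = "\<lambda>t. K / \<alpha> * t powr \<alpha>"])
      show "continuous_on {x..1} (\<lambda>t. F (Complex t \<eta>))"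
      proof (intro continuous_at_imp_continuous_on ballI)
        fix t assume "t \<in> {x..1}"
        then have "0 < t" using x by simp
        then show "isCont (\<lambda>t. F (Complex t \<eta>)) t" by (rule has_vector_derivative_continuous[OF dF])
      qed
      show "continuous_on {x..1} (\<lambda>t. K / \<alpha> * t powr \<alpha>)"
        using x by (intro continuous_intros) auto
      fix t assume t: "x < t" "t < 1"
      show "((\<lambda>t. F (Complex t \<eta>)) has_vector_derivative deriv F (Complex t \<eta>)) (at t)"
        using dF t x by simp
      have "((\<lambda>t. K / \<alpha> * t powr \<alpha>) has_real_derivative K * t powr (\<alpha> - 1)) (at t)"
        using t x \<alpha> by (auto intro!: derivative_eq_intros)
      then show "((\<lambda>t. K / \<alpha> * t powr \<alpha>) has_vector_derivative K * t powr (\<alpha> - 1)) (at t)"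
        by (simp add: has_real_derivative_iff_has_vector_derivative)
      have "(t + 1)\<^sup>2 \<le> 2\<^sup>2" using t x by (intro power_mono) auto
      then have "(cmod (Complex t \<eta> + 1))\<^sup>2 \<le> 4 + \<eta>\<^sup>2"
        by (simp add: cmod_power2)
      then have "((cmod (Complex t \<eta> + 1))\<^sup>2 / t) powr (1 - \<alpha>) \<le> ((4 + \<eta>\<^sup>2) / t) powr (1 - \<alpha>)"
        using t x \<alpha> by (intro powr_mono2 divide_right_mono) auto
      also have "\<dots> = (4 + \<eta>\<^sup>2) powr (1 - \<alpha>) * t powr (\<alpha> - 1)"
        using t x by (simp add: powr_divide powr_diff field_simps)
      finally have "C * ((cmod (Complex t \<eta> + 1))\<^sup>2 / t) powr (1 - \<alpha>) \<le> K * t powr (\<alpha> - 1)"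
        using C(1) by (simp add: K_def mult.assoc)
      then show "cmod (deriv F (Complex t \<eta>)) \<le> K * t powr (\<alpha> - 1)"
        using C(2)[of "Complex t \<eta>"] t x by simp
    qed (use x in auto)
    moreover have "K / \<alpha> * x powr \<alpha> \<ge> 0" using C \<alpha> by (simp add: K_def)
    ultimately have "cmod (F (Complex 1 \<eta>) - F (Complex x \<eta>)) \<le> K / \<alpha>" by simp
    then show ?thesis
      using norm_triangle_ineq2[of "F (Complex x \<eta>)" "F (Complex 1 \<eta>)"] by (simp add: norm_minus_commute)
  qed
  then show ?thesis using that by blast
qed

text \<open>On the positive axis one integrates the lower bound for the derivative. For \<open>w\<close> close to the imaginary
axis that bound degenerates along the segment from \<open>1\<close> to \<open>w\<close>. The path is therefore bent through a
point \<open>p\<close> near \<open>w / 2\<close> but shifted to the right by a small multiple of \<open>cmod w\<close>: the first leg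
stays in a Stolz angle, where the bound is of the right order. Both legs still have nearly the
direction of \<open>w\<close>, and the derivative ranges in a sector of angle less than \<open>pi\<close>, so both increments
of \<open>F\<close> have nonnegative component along \<open>w\<close>. The second leg thus cannot undo the gain on the
first. Increments are evaluated by the mean value theorem for the component along \<open>w\<close>.\<close>

lemma growth_in_half_plane:
  assumes \<alpha>: "0 < \<alpha>" "\<alpha> < 1" and hol: "F holomorphic_on right_half_plane"
    and k: "0 < k" "k \<le> 1" "\<And>w. 0 < Re w \<Longrightarrow> k * cmod (deriv F w) \<le> Re (deriv F w)"
    and c: "0 < c" "\<And>w. 0 < Re w \<Longrightarrow> c * (Re w / (cmod (w + 1))\<^sup>2) powr (1 - \<alpha>) \<le> cmod (deriv F w)"
  obtains \<delta> R where "0 < \<delta>" "\<And>w. 0 < Re w \<Longrightarrow> R \<le> cmod w \<Longrightarrow> \<delta> * cmod w powr \<alpha> \<le> cmod (F w)"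
proof -
  \<comment> \<open>The shift \<open>\<kappa> * cmod w\<close> may turn each leg only so far that it stays within the margin \<open>k\<close> of
the sector of derivatives: half of that margin, \<open>k / 2\<close>, is spent on the shift.\<close>
  define \<kappa> where "\<kappa> = k / 4"
  define c1 where "c1 = k / 8 * (c * (\<kappa> / 16) powr (1 - \<alpha>))"
  have \<kappa>: "0 < \<kappa>" "\<kappa> \<le> 1 / 4" using k by (auto simp: \<kappa>_def)
  have c1: "0 < c1" using k c \<kappa> by (simp add: c1_def)
  have mvt: "\<exists>v\<in>closed_segment p q. Re (m * (F q - F p)) = Re (m * (q - p) * deriv F v)"
    if "0 < Re p" "0 < Re q" for p q m
  proof -
    have cs: "closed_segment p q \<subseteq> right_half_plane"
      using that by (intro closed_segment_subset convex_halfspace_Re_gt) auto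
    have "((\<lambda>v. m * F v) has_field_derivative m * deriv F v) (at v)" if "v \<in> closed_segment p q" for v
      using cs that by (intro DERIV_cmult holomorphic_derivI[OF hol open_halfspace_Re_gt]) auto
    then obtain v where "v \<in> closed_segment p q" "Re (m * F q) - Re (m * F p) = Re (m * deriv F v * (q - p))"
      using complex_mvt_line[of p q "\<lambda>v. m * F v" "\<lambda>v. m * deriv F v"] by blast
    then show ?thesis
      by (intro bexI[of _ v]) (simp_all only: right_diff_distrib minus_complex.sel mult_ac)
  qed
  have main: "c1 * cmod w powr \<alpha> - cmod (F 1) \<le> cmod (F w)" if w: "0 < Re w" "8 / k \<le> cmod w" for w
  proof -
    define r u where "r = cmod w" and "u = w / of_real (cmod w)"
    have r: "8 / k \<le> r" "0 < r" "8 \<le> k * r" "2 \<le> \<kappa> * r" "8 \<le> r"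
    proof -
      have "0 < 8 / k" using k by simp
      then show "8 / k \<le> r" "0 < r" using w by (auto simp: r_def)
      then show "8 \<le> k * r" using k by (simp add: field_simps)
      then show "2 \<le> \<kappa> * r" by (simp add: \<kappa>_def)
      have "k * r \<le> 1 * r" using k \<open>0 < r\<close> by (intro mult_right_mono) auto
      then show "8 \<le> r" using \<open>8 \<le> k * r\<close> by linarith
    qed
    have u: "cmod u = 1" "w = of_real r * u" 
      using r by (simp_all add: u_def r_def norm_divide)
    have uw: "cnj u * w = of_real r"
    proof -
      have "cnj u * w = of_real r * (u * cnj u)" using u(2) by (simp add: mult_ac)
      then show ?thesis using u(1) by (simp add: complex_norm_square[symmetric])
    qed
    define p where "p = w / 2 + of_real (\<kappa> * r)"
    have Rep: "Re p \<ge> \<kappa> * r" using w by (simp add: p_def)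
    have p0: "0 < Re p" using Rep r \<kappa> by linarith
    \<comment> \<open>A leg is \<open>s\<close> times the direction \<open>u\<close> plus a horizontal part \<open>x\<close>; the horizontal part
costs at most \<open>\<bar>x\<bar> * cmod A\<close>.\<close>
    have rot: "s * cmod A * k - y * cmod A \<le> Re ((of_real s + of_real x * cnj u) * A)"
      if "k * cmod A \<le> Re A" "\<bar>x\<bar> \<le> y" "0 \<le> s" for A s x y
    proof -
      have "\<bar>Re (of_real x * cnj u * A)\<bar> \<le> cmod (of_real x * cnj u * A)" by (rule abs_Re_le_cmod)
      also have "\<dots> = \<bar>x\<bar> * cmod A" using u(1) by (simp add: norm_mult)
      also have "\<dots> \<le> y * cmod A" using that by (intro mult_right_mono) auto
      finally have "- (y * cmod A) \<le> Re (of_real x * cnj u * A)" by linarith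
      moreover have "s * (k * cmod A) \<le> s * Re A" using that by (intro mult_left_mono)
      moreover have "Re ((of_real s + of_real x * cnj u) * A) = s * Re A + Re (of_real x * cnj u * A)"
        by (simp add: algebra_simps)
      ultimately show ?thesis by (simp add: algebra_simps)
    qed
    obtain v where v: "v \<in> closed_segment p w" and v2: "Re (cnj u * (F w - F p)) = Re (cnj u * (w - p) * deriv F v)"
      using mvt[OF p0 w(1)] by blast
    have v0: "0 < Re v"
      using closed_segment_subset[of p right_half_plane w] convex_halfspace_Re_gt p0 w v by blast
    have "cnj u * (w - p) = of_real (r / 2) + of_real (- (\<kappa> * r)) * cnj u"
      using uw by (simp add: p_def algebra_simps)
    then have "Re (cnj u * (F w - F p)) \<ge> r / 2 * cmod (deriv F v) * k - \<kappa> * r * cmod (deriv F v)"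
      unfolding v2 using r \<kappa> by (simp only:) (intro rot k v0; simp)
    also have "r / 2 * cmod (deriv F v) * k - \<kappa> * r * cmod (deriv F v) = k * r / 4 * cmod (deriv F v)"
      by (simp add: \<kappa>_def algebra_simps)
    finally have A1: "0 \<le> Re (cnj u * (F w - F p))"
      using k r order_trans[of 0 "k * r / 4 * cmod (deriv F v)"] by simp
    have "0 < Re (1::complex)" by simp
    from mvt[OF this p0, of "cnj u"]
    obtain q where q: "q \<in> closed_segment 1 p" and q2: "Re (cnj u * (F p - F 1)) = Re (cnj u * (p - 1) * deriv F q)"
      by blast
    obtain t where t: "0 \<le> t" "t \<le> 1" and qt: "q = 1 + of_real t * (p - 1)"
      using q by (auto simp: closed_segment_def scaleR_conv_of_real algebra_simps)
    have Req: "Re q \<ge> 1 + t * (\<kappa> * r / 2)"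
    proof -
      have "t * (\<kappa> * r / 2) \<le> t * (Re p - 1)" using t Rep r by (intro mult_left_mono) auto
      then show ?thesis by (simp add: qt)
    qed
    have q0: "1 \<le> Re q"
    proof -
      have "0 \<le> t * (\<kappa> * r / 2)" using t r by simp
      with Req show ?thesis by linarith
    qed
    have pn: "cmod (p - 1) \<le> 2 * r"
    proof -
      have "cmod (p - 1) \<le> cmod p + 1" using norm_triangle_ineq4[of p 1] by simp
      also have "cmod p \<le> r / 2 + \<kappa> * r"
        unfolding p_def using norm_triangle_ineq[of "w / 2" "of_real (\<kappa> * r)"] \<kappa> r 
        by (simp add: norm_mult norm_divide flip: r_def)
      also have "\<kappa> * r \<le> r / 4" using \<kappa> r mult_right_mono[of \<kappa> "1/4" r] by simp
      finally show ?thesis using r by simp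
    qed
    have qn: "cmod (q + 1) \<le> 2 + 2 * (t * r)"
    proof -
      have "q + 1 = 2 + of_real t * (p - 1)" by (simp add: qt)
      then have "cmod (q + 1) \<le> 2 + t * cmod (p - 1)"
        using norm_triangle_ineq[of 2 "of_real t * (p - 1)"] t by (simp add: norm_mult)
      also have "t * cmod (p - 1) \<le> t * (2 * r)" using pn t by (intro mult_left_mono)
      finally show ?thesis by (simp add: algebra_simps)
    qed
    have qn1: "\<kappa> / 4 * cmod (q + 1) \<le> Re q"
    proof -
      have "\<kappa> / 4 * cmod (q + 1) \<le> \<kappa> / 4 * (2 + 2 * (t * r))" using qn \<kappa> by (intro mult_left_mono) auto
      also have "\<dots> = \<kappa> / 2 + t * (\<kappa> * r / 2)" by (simp add: algebra_simps)
      also have "\<dots> \<le> 1 + t * (\<kappa> * r / 2)" using \<kappa> by simp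
      finally show ?thesis using Req by (rule order_trans)
    qed
    have qn2: "cmod (q + 1) \<le> 4 * r"
    proof -
      have "t * r \<le> r" using t r mult_right_mono[of t 1 r] by simp
      with qn r show ?thesis by linarith
    qed
    have qpos: "0 < cmod (q + 1)" using q0 by (auto simp: complex_eq_iff)
    \<comment> \<open>In the Stolz angle the degenerate factor is at least a constant multiple of the reciprocal of
\<open>cmod (q + 1)\<close>, hence of \<open>1 / r\<close>.\<close>
    have "\<kappa> / (16 * r) \<le> \<kappa> / 4 / cmod (q + 1)"
      using qn2 qpos r \<kappa> by (simp add: field_simps)
    also have "\<dots> \<le> Re q / (cmod (q + 1))\<^sup>2"
      using qn1 qpos by (simp add: field_simps power2_eq_square)
    finally have "(\<kappa> / (16 * r)) powr (1 - \<alpha>) \<le> (Re q / (cmod (q + 1))\<^sup>2) powr (1 - \<alpha>)"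
      using \<kappa> r \<alpha> by (intro powr_mono2) auto
    moreover have "(\<kappa> / (16 * r)) powr (1 - \<alpha>) = (\<kappa> / 16) powr (1 - \<alpha>) * (r powr \<alpha> / r)"
      using \<kappa> r by (simp add: powr_divide powr_mult powr_diff field_simps)
    ultimately have "c * ((\<kappa> / 16) powr (1 - \<alpha>) * (r powr \<alpha> / r)) \<le> c * (Re q / (cmod (q + 1))\<^sup>2) powr (1 - \<alpha>)"
      using c(1) by (intro mult_left_mono) auto
    also have "\<dots> \<le> cmod (deriv F q)" using c(2)[of q] q0 by simp
    finally have "c * ((\<kappa> / 16) powr (1 - \<alpha>) * (r powr \<alpha> / r)) \<le> cmod (deriv F q)" .
    then have dq: "c1 * (r powr \<alpha>) \<le> k * r / 8 * cmod (deriv F q)"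
      using r k by (simp add: c1_def field_simps)
    have "cnj u * (p - 1) = of_real (r / 2) + of_real (\<kappa> * r - 1) * cnj u"
      using uw by (simp add: p_def algebra_simps)
    then have "Re (cnj u * (F p - F 1)) \<ge> r / 2 * cmod (deriv F q) * k - \<kappa> * r * cmod (deriv F q)"
      unfolding q2 using r \<kappa> q0 by (simp only:) (intro rot k; simp)
    also have "r / 2 * cmod (deriv F q) * k - \<kappa> * r * cmod (deriv F q) = k * r / 4 * cmod (deriv F q)"
      by (simp add: \<kappa>_def algebra_simps)
    finally have "c1 * r powr \<alpha> \<le> Re (cnj u * (F p - F 1))"
    proof -
      assume "k * r / 4 * cmod (deriv F q) \<le> Re (cnj u * (F p - F 1))"
      moreover have "k * r / 8 * cmod (deriv F q) \<le> k * r / 4 * cmod (deriv F q)"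
        using k r by (intro mult_right_mono) auto
      ultimately show ?thesis using dq by linarith
    qed
    with A1 have "c1 * r powr \<alpha> \<le> Re (cnj u * (F w - F 1))" by (simp add: algebra_simps)
    also have "\<dots> \<le> cmod (cnj u * (F w - F 1))" by (rule complex_Re_le_cmod)
    also have "\<dots> \<le> cmod (F w) + cmod (F 1)"
      using u(1) norm_triangle_ineq4[of "F w" "F 1"] by (simp add: norm_mult)
    finally show ?thesis by (simp add: r_def)
  qed
  \<comment> \<open>Beyond \<open>R\<close> the term \<open>cmod (F 1)\<close> is at most half of the main term.\<close>
  define R where "R = max (8 / k) ((2 * cmod (F 1) / c1 + 1) powr (1 / \<alpha>))"
  show ?thesis
  proof (rule that)
    show "0 < c1 / 2" using c1 by simp
    fix w assume w: "0 < Re w" "R \<le> cmod w"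
    have "2 * cmod (F 1) / c1 + 1 \<le> cmod w powr \<alpha>"
    proof -
      have "((2 * cmod (F 1) / c1 + 1) powr (1 / \<alpha>)) powr \<alpha> \<le> cmod w powr \<alpha>"
        using w \<alpha> by (intro powr_mono2) (auto simp: R_def)
      then show ?thesis using \<alpha> c1 by (simp add: powr_powr add_nonneg_nonneg)
    qed
    then have "2 * cmod (F 1) \<le> c1 * cmod w powr \<alpha>"
      using c1 by (simp add: field_simps)
    with main[of w] w show "c1 / 2 * cmod w powr \<alpha> \<le> cmod (F w)" by (simp add: R_def)
  qed
qed

section \<open>The half-plane model of the mapping\<close>

lemma directions_near_bisector:
  assumes "0 < A"
  obtains c where "0 < c" "\<And>v. cmod v < c \<Longrightarrow> \<exists>\<rho> t. 0 \<le> \<rho> \<and> a < t \<and> t < a + A \<and> cis (a + A / 2) + v = of_real \<rho> * cis t"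
proof -
  have "isCont Arg 1" by (rule continuous_at_Arg) simp
  then obtain c where c: "0 < c" "\<And>y. dist y 1 < c \<Longrightarrow> dist (Arg y) (Arg 1) < A / 2"
    using assms unfolding continuous_at_eps_delta by (metis half_gt_zero)
  show ?thesis
  proof (rule that[OF c(1)])
    fix v assume v: "cmod v < c"
    define y where "y = 1 + v * cis (- (a + A / 2))"
    have "dist (Arg y) (Arg 1) < A / 2"
      using v by (intro c(2)) (simp add: y_def dist_norm norm_mult)
    moreover have "Arg 1 = 0" by (simp add: Arg_eq_0)
    ultimately have arg: "\<bar>Arg y\<bar> < A / 2" by (simp add: dist_real_def)
    have "cis (a + A / 2) + v = y * cis (a + A / 2)"
      by (simp add: y_def distrib_right mult.assoc cis_mult)
    also have "\<dots> = rcis (cmod y) (Arg y) * cis (a + A / 2)"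
      by (simp only: rcis_cmod_Arg)
    also have "\<dots> = of_real (cmod y) * cis (Arg y + (a + A / 2))"
      by (simp only: rcis_def mult.assoc cis_mult)
    finally show "\<exists>\<rho> t. 0 \<le> \<rho> \<and> a < t \<and> t < a + A \<and> cis (a + A / 2) + v = of_real \<rho> * cis t"
      using arg by (intro exI[of _ "cmod y"] exI[of _ "Arg y + (a + A / 2)"]) auto
  qed
qed

text \<open>Far out along the bisector of the arc of recession directions, the range of \<open>g\<close> contains balls of
radii proportional to the distance. A boundary point \<open>\<xi>\<close> to which the preimages of their centres
accumulate serves for all directions of the arc at once.\<close>

lemma common_boundary_point:
  assumes g: "g holomorphic_on ball 0 1"
    and G: "G holomorphic_on g ` ball 0 1" "\<And>z. z \<in> ball 0 1 \<Longrightarrow> G (g z) = z"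
    and A: "0 < A" "\<And>t p r. a < t \<Longrightarrow> t < a + A \<Longrightarrow> p \<in> g ` ball 0 1 \<Longrightarrow> 0 \<le> r \<Longrightarrow> p + of_real r * cis t \<in> g ` ball 0 1"
  shows "\<exists>\<xi>. cmod \<xi> = 1 \<and> (\<forall>t r z. a < t \<longrightarrow> t < a + A \<longrightarrow> 0 \<le> r \<longrightarrow> z \<in> ball 0 1 \<longrightarrow>
       Re ((\<xi> + z) / (\<xi> - z)) \<le> Re ((\<xi> + G (g z + of_real r * cis t)) / (\<xi> - G (g z + of_real r * cis t))))"
proof -
  obtain c where c: "0 < c" "\<And>v. cmod v < c \<Longrightarrow> \<exists>\<rho> t. 0 \<le> \<rho> \<and> a < t \<and> t < a + A \<and> cis (a + A / 2) + v = of_real \<rho> * cis t"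
    using directions_near_bisector[OF A(1)] by metis
  define p where "p n = g 0 + of_real (real n) * cis (a + A / 2)" for n :: nat
  define R where "R n = c * real n" for n :: nat
  have g0: "g 0 \<in> g ` ball 0 1" by simp
  have p: "p n \<in> g ` ball 0 1" for n
    unfolding p_def using A(1) by (intro A(2) g0) auto
  have R: "ball (p n) (R n) \<subseteq> g ` ball 0 1" for n
  proof
    fix x assume x: "x \<in> ball (p n) (R n)"
    then have n: "0 < real n" using c(1) le_less_trans[OF zero_le_dist, of "p n" x "R n"]
      by (simp add: R_def zero_less_mult_iff)
    define v where "v = (x - p n) / of_real (real n)"
    have "cmod v < c"
      using x n by (simp add: v_def R_def dist_norm norm_minus_commute norm_divide field_simps)
    then obtain \<rho> t where t: "0 \<le> \<rho>" "a < t" "t < a + A" "cis (a + A / 2) + v = of_real \<rho> * cis t"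
      using c(2) by blast
    have "x = g 0 + of_real (real n) * (cis (a + A / 2) + v)"
      using n by (simp add: v_def p_def field_simps)
    also have "\<dots> = g 0 + of_real (real n * \<rho>) * cis t"
      unfolding t(4) by simp
    also have "\<dots> \<in> g ` ball 0 1"
      using t by (intro A(2) g0) auto
    finally show "x \<in> g ` ball 0 1" .
  qed
  have G1: "G w \<in> ball 0 1" "g (G w) = w" if "w \<in> g ` ball 0 1" for w
    using that G(2) by auto
  have "G (p n) \<in> cball 0 1" for n using G1(1)[OF p[of n]] by simp
  then obtain \<xi> \<sigma> where \<sigma>: "strict_mono \<sigma>" "((\<lambda>n. G (p n)) \<circ> \<sigma>) \<longlonglongrightarrow> \<xi>" and \<xi>: "\<xi> \<in> cball 0 1"
    using compact_cball[of "0::complex" 1] unfolding compact_def by meson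
  have lim: "(\<lambda>n. G (p (\<sigma> n))) \<longlonglongrightarrow> \<xi>" using \<sigma>(2) by (simp add: o_def)
  \<comment> \<open>The values of \<open>g\<close> along the sequence are unbounded, so the limit cannot lie inside the disc.\<close>
  have \<xi>1: "cmod \<xi> = 1"
  proof (rule ccontr)
    assume "cmod \<xi> \<noteq> 1"
    with \<xi> have "\<xi> \<in> ball 0 1" by simp
    then have "isCont g \<xi>"
      using holomorphic_on_imp_continuous_on[OF g] continuous_on_eq_continuous_at[OF open_ball] by blast
    then have "(\<lambda>n. g (G (p (\<sigma> n)))) \<longlonglongrightarrow> g \<xi>"
      using lim by (rule isCont_tendsto_compose)
    then have "(\<lambda>n. p (\<sigma> n)) \<longlonglongrightarrow> g \<xi>" using G1(2)[OF p] by simp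
    then have "(\<lambda>n. norm (p (\<sigma> n) - g 0)) \<longlonglongrightarrow> norm (g \<xi> - g 0)"
      by (intro tendsto_intros)
    then have "(\<lambda>n. real (\<sigma> n)) \<longlonglongrightarrow> norm (g \<xi> - g 0)"
      by (simp add: p_def norm_mult)
    moreover have "filterlim (\<lambda>n. real (\<sigma> n)) at_top sequentially"
      by (rule filterlim_compose[OF filterlim_real_sequentially filterlim_subseq[OF \<sigma>(1)]])
    ultimately show False
      using not_tendsto_and_filterlim_at_infinity[OF sequentially_bot]
        filterlim_at_top_imp_at_infinity by blast
  qed
  have Rlim: "filterlim (\<lambda>n. R (\<sigma> n)) at_top sequentially"
    unfolding R_def
    by (intro filterlim_tendsto_pos_mult_at_top[OF tendsto_const c(1)]
          filterlim_compose[OF filterlim_real_sequentially filterlim_subseq[OF \<sigma>(1)]])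
  show ?thesis
  proof (intro exI conjI allI impI, rule \<xi>1)
    fix t r z assume t: "a < t" "t < a + A" "0 \<le> (r::real)" and z: "z \<in> ball (0::complex) 1"
    show "Re ((\<xi> + z) / (\<xi> - z)) \<le> Re ((\<xi> + G (g z + of_real r * cis t)) / (\<xi> - G (g z + of_real r * cis t)))"
      by (rule translation_increases_Re[OF g G _ Rlim R p lim \<xi>1 z]) (use A t in auto)
  qed
qed

text \<open>The inverse of \<open>z \<mapsto> (\<xi> + z) / (\<xi> - z)\<close>, mapping the right half-plane to the disc and infinity
to \<open>\<xi>\<close>.\<close>

definition half_plane_chart :: "complex \<Rightarrow> complex \<Rightarrow> complex" where
  "half_plane_chart \<xi> w = \<xi> * ((w - 1) / (w + 1))"

lemma half_plane_chart_in_ball: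
  assumes "cmod \<xi> = 1" "0 < Re w"
  shows "half_plane_chart \<xi> w \<in> ball 0 1"
  using assms Cayley_in_disc(1) unfolding half_plane_chart_def mem_ball_0 norm_mult by simp

lemma half_plane_chart_inverse:
  assumes "\<xi> \<noteq> 0" "w + 1 \<noteq> 0"
  shows "(\<xi> + half_plane_chart \<xi> w) / (\<xi> - half_plane_chart \<xi> w) = w"
proof -
  have "\<xi> + half_plane_chart \<xi> w = \<xi> * (2 * w / (w + 1))" "\<xi> - half_plane_chart \<xi> w = \<xi> * (2 / (w + 1))"
    using assms(2) by (simp_all add: half_plane_chart_def field_simps)
  then show ?thesis using assms by simp
qed

lemma half_plane_chart_of_inverse:
  assumes "\<xi> \<noteq> 0" "z \<noteq> \<xi>"
  shows "half_plane_chart \<xi> ((\<xi> + z) / (\<xi> - z)) = z"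
proof -
  have nz: "\<xi> - z \<noteq> 0" using assms by simp
  have "(\<xi> + z) / (\<xi> - z) - 1 = 2 * z / (\<xi> - z)" "(\<xi> + z) / (\<xi> - z) + 1 = 2 * \<xi> / (\<xi> - z)"
    using nz by (simp_all add: field_simps)
  then show ?thesis using assms nz by (simp add: half_plane_chart_def)
qed

lemma holomorphic_half_plane_chart: "half_plane_chart \<xi> holomorphic_on right_half_plane"
proof -
  have "w + 1 \<noteq> 0" if "0 < Re w" for w using that by (auto simp: complex_eq_iff)
  then show ?thesis unfolding half_plane_chart_def by (intro holomorphic_intros) auto
qed

text \<open>If translating in the direction \<open>cis t\<close> does not decrease \<open>Re K\<close>, where \<open>K\<close> inverts \<open>F\<close>, then
\<open>cis t\<close> times the derivative of \<open>K\<close> has nonnegative real part, and that derivative is the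
reciprocal of the derivative of \<open>F\<close>.\<close>

lemma derivative_direction:
  assumes F: "F holomorphic_on right_half_plane" and K: "K holomorphic_on S" "open S"
    and FS: "\<And>w. 0 < Re w \<Longrightarrow> F w \<in> S" and KF: "\<And>w. 0 < Re w \<Longrightarrow> K (F w) = w"
    and inc: "\<And>w r. 0 < Re w \<Longrightarrow> 0 \<le> r \<Longrightarrow> Re w \<le> Re (K (F w + of_real r * cis t))"
    and w: "0 < Re w"
  shows "deriv F w \<noteq> 0" "0 \<le> Re (cis (- t) * deriv F w)"
proof -
  have dF: "(F has_field_derivative deriv F w) (at w)"
    using w by (intro holomorphic_derivI[OF F open_halfspace_Re_gt]) simp
  have dK: "(K has_field_derivative deriv K (F w)) (at (F w))"
    by (rule holomorphic_derivI[OF K FS[OF w]])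
  have "((\<lambda>w. w) has_field_derivative deriv K (F w) * deriv F w) (at w)"
    by (rule has_field_derivative_transform_within_open[OF DERIV_chain2[OF dK dF] open_halfspace_Re_gt])
       (use w KF in auto)
  from DERIV_unique[OF this DERIV_ident] have inv: "deriv K (F w) * deriv F w = 1" .
  then show nz: "deriv F w \<noteq> 0" by auto
  define \<rho> where "\<rho> r = Re (K (F w + of_real r * cis t))" for r
  have d0: "((\<lambda>r. F w + of_real r * cis t) has_vector_derivative cis t) (at (0::real))"
    by (auto intro!: derivative_eq_intros)
  have "(K has_field_derivative deriv K (F w)) (at (F w + of_real 0 * cis t))" using dK by simp
  from field_vector_diff_chain_at[OF d0 this]
  have "((\<lambda>r. K (F w + of_real r * cis t)) has_vector_derivative cis t * deriv K (F w)) (at 0)"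
    by (simp add: o_def)
  then have d\<rho>: "(\<rho> has_real_derivative Re (cis t * deriv K (F w))) (at 0)"
    unfolding \<rho>_def has_real_derivative_iff_has_vector_derivative
    by (rule bounded_linear.has_vector_derivative[OF bounded_linear_Re])
  have "0 \<le> Re (cis t * deriv K (F w))"
  proof (rule ccontr)
    assume "\<not> ?thesis"
    then obtain e where e: "0 < e" "\<forall>h>0. h < e \<longrightarrow> \<rho> (0 + h) < \<rho> 0"
      using DERIV_neg_dec_right[OF d\<rho>] by auto
    then have "\<rho> (e / 2) < \<rho> 0" by simp
    moreover have "\<rho> 0 \<le> \<rho> (e / 2)"
      using inc[OF w, of "e / 2"] e KF[OF w] by (simp add: \<rho>_def)
    ultimately show False by simp
  qed
  moreover have "deriv K (F w) = 1 / deriv F w" using inv nz by (simp add: field_simps)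
  ultimately have "0 \<le> Re (cis t * cnj (deriv F w)) / (cmod (deriv F w))\<^sup>2"
    by (simp only: times_divide_eq_right mult_1_right complex_div_cnj[of "cis t"] of_real_power[symmetric] Re_divide_of_real)
  then have "0 \<le> Re (cis t * cnj (deriv F w))"
    using nz by (simp add: zero_le_divide_iff)
  then show "0 \<le> Re (cis (- t) * deriv F w)"
    by simp
qed

text \<open>After a rotation of the plane the recession arc is centred on the positive axis. The derivative then
makes an angle of at most \<open>pi / 2\<close> with each direction of an arc of length \<open>pi * \<alpha>\<close>.\<close>

lemma half_plane_model:
  assumes g: "g holomorphic_on ball 0 1" "inj_on g (ball 0 1)" "convex (g ` ball 0 1)"
    and \<alpha>: "0 < \<alpha>" "\<alpha> < 1" "angle_at_infinity (g ` ball 0 1) = pi * \<alpha>"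
  obtains \<xi> F where "cmod \<xi> = 1" "F holomorphic_on right_half_plane"
    "\<And>w. 0 < Re w \<Longrightarrow> cmod (F w) = cmod (g (half_plane_chart \<xi> w))"
    "\<And>w. 0 < Re w \<Longrightarrow> deriv F w \<noteq> 0"
    "\<And>w s. 0 < Re w \<Longrightarrow> \<bar>s\<bar> < pi * \<alpha> / 2 \<Longrightarrow> 0 \<le> Re (cis s * deriv F w)"
proof -
  define S where "S = g ` ball 0 1"
  have openS: "open S" unfolding S_def by (rule open_mapping_thm3[OF g(1) open_ball g(2)])
  have "pi * \<alpha> < pi * 1" using \<alpha> by (intro mult_strict_left_mono) auto
  then have ang: "0 < angle_at_infinity S" "angle_at_infinity S < pi"
    using \<alpha> by (auto simp: S_def)
  obtain a where a: "\<And>t p r. a < t \<Longrightarrow> t < a + pi * \<alpha> \<Longrightarrow> p \<in> S \<Longrightarrow> 0 \<le> r \<Longrightarrow> p + of_real r * cis t \<in> S"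
    using recession_arc[OF openS g(3)[folded S_def] ang] \<alpha>(3) unfolding S_def by metis
  obtain G where G: "G holomorphic_on S" "\<And>z. z \<in> ball 0 1 \<Longrightarrow> G (g z) = z"
    using holomorphic_has_inverse[OF g(1) open_ball g(2)] unfolding S_def by metis
  have \<alpha>0: "0 < pi * \<alpha>" using \<alpha> by simp
  have "\<exists>\<xi>. cmod \<xi> = 1 \<and> (\<forall>t r z. a < t \<longrightarrow> t < a + pi * \<alpha> \<longrightarrow> 0 \<le> r \<longrightarrow> z \<in> ball 0 1 \<longrightarrow>
       Re ((\<xi> + z) / (\<xi> - z)) \<le> Re ((\<xi> + G (g z + of_real r * cis t)) / (\<xi> - G (g z + of_real r * cis t))))"
    by (rule common_boundary_point[OF g(1) G(1)[unfolded S_def] G(2) \<alpha>0 a[unfolded S_def]])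
  then obtain \<xi> where \<xi>: "cmod \<xi> = 1"
    and inc: "\<And>t r z. a < t \<Longrightarrow> t < a + pi * \<alpha> \<Longrightarrow> 0 \<le> r \<Longrightarrow> z \<in> ball 0 1 \<Longrightarrow> 
       Re ((\<xi> + z) / (\<xi> - z)) \<le> Re ((\<xi> + G (g z + of_real r * cis t)) / (\<xi> - G (g z + of_real r * cis t)))"
    by blast
  define F where "F w = g (half_plane_chart \<xi> w)" for w
  define K where "K \<zeta> = (\<xi> + G \<zeta>) / (\<xi> - G \<zeta>)" for \<zeta>
  have \<xi>0: "\<xi> \<noteq> 0" using \<xi> by auto
  have nz: "w + 1 \<noteq> 0" if "0 < Re w" for w using that by (auto simp: complex_eq_iff)
  have FS: "F w \<in> S" if "0 < Re w" for w
    using half_plane_chart_in_ball[OF \<xi> that] by (simp add: F_def S_def)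
  have "(g \<circ> half_plane_chart \<xi>) holomorphic_on right_half_plane"
    by (rule holomorphic_on_compose_gen[OF holomorphic_half_plane_chart g(1)])
       (use half_plane_chart_in_ball[OF \<xi>] in auto)
  then have Fhol: "F holomorphic_on right_half_plane" by (simp add: F_def[abs_def] o_def)
  have GS: "G \<zeta> \<in> ball 0 1" if "\<zeta> \<in> S" for \<zeta> using that G(2) by (auto simp: S_def)
  have "\<xi> - G \<zeta> \<noteq> 0" if "\<zeta> \<in> S" for \<zeta>
    using GS[OF that] \<xi> by auto
  then have Khol: "K holomorphic_on S"
    unfolding K_def by (intro holomorphic_intros G)
  have GF: "G (F w) = half_plane_chart \<xi> w" if "0 < Re w" for w
    unfolding F_def by (rule G(2)[OF half_plane_chart_in_ball[OF \<xi> that]])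
  have KF: "K (F w) = w" if "0 < Re w" for w
    unfolding K_def GF[OF that] by (rule half_plane_chart_inverse[OF \<xi>0 nz[OF that]])
  have dir: "deriv F w \<noteq> 0" "0 \<le> Re (cis (- t) * deriv F w)"
    if w: "0 < Re w" and t: "a < t" "t < a + pi * \<alpha>" for w t
  proof -
    have incF: "Re v \<le> Re (K (F v + of_real r * cis t))" if "0 < Re v" "0 \<le> r" for v r
      using inc[OF t that(2) half_plane_chart_in_ball[OF \<xi> that(1)]]
      unfolding half_plane_chart_inverse[OF \<xi>0 nz[OF that(1)]] by (simp add: K_def F_def)
    show "deriv F w \<noteq> 0" "0 \<le> Re (cis (- t) * deriv F w)"
      using derivative_direction[OF Fhol Khol openS FS KF incF w] by blast+
  qed
  define \<mu> where "\<mu> = a + pi * \<alpha> / 2"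
  have d: "deriv (\<lambda>w. cis (- \<mu>) * F w) w = cis (- \<mu>) * deriv F w" if "0 < Re w" for w
    using that by (intro deriv_cmult holomorphic_on_imp_differentiable_at[OF Fhol open_halfspace_Re_gt]) simp
  show ?thesis
  proof (rule that[of \<xi> "\<lambda>w. cis (- \<mu>) * F w"])
    show "cmod \<xi> = 1" by (rule \<xi>)
    show "(\<lambda>w. cis (- \<mu>) * F w) holomorphic_on right_half_plane"
      by (intro holomorphic_intros Fhol)
    fix w assume w: "0 < Re w"
    show "cmod (cis (- \<mu>) * F w) = cmod (g (half_plane_chart \<xi> w))"
      by (simp add: norm_mult F_def)
    show "deriv (\<lambda>w. cis (- \<mu>) * F w) w \<noteq> 0"
      unfolding d[OF w] using dir(1)[OF w, of \<mu>] \<alpha> by (auto simp: \<mu>_def)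
    fix s assume s: "\<bar>s\<bar> < pi * \<alpha> / 2"
    have "0 \<le> Re (cis (- (\<mu> - s)) * deriv F w)"
      using s by (intro dir(2)[OF w]) (auto simp: \<mu>_def)
    also have "cis (- (\<mu> - s)) = cis s * cis (- \<mu>)" by (simp add: cis_mult)
    finally show "0 \<le> Re (cis s * deriv (\<lambda>w. cis (- \<mu>) * F w) w)"
      unfolding d[OF w] by (simp only: mult.assoc)
  qed
qed

text \<open>A boundary point \<open>1\<close> different from \<open>\<xi>\<close> corresponds to a finite point \<open>w0\<close> of the imaginary axis,
near which \<open>g\<close> would be bounded along a horizontal segment, whereas \<open>g\<close> tends to infinity at \<open>1\<close>.\<close>

lemma boundary_point_eq_one:
  assumes \<xi>: "cmod \<xi> = 1" and inf: "filterlim g at_infinity (at 1 within ball 0 1)"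
    and bdd: "\<And>\<eta>. \<exists>M. \<forall>x. 0 < x \<longrightarrow> x < 1 \<longrightarrow> cmod (g (half_plane_chart \<xi> (Complex x \<eta>))) \<le> M"
  shows "\<xi> = 1"
proof (rule ccontr)
  assume ne: "\<xi> \<noteq> 1"
  define w0 where "w0 = (\<xi> + 1) / (\<xi> - 1)"
  have "Re w0 = 0"
    unfolding w0_def Re_Cayley[OF \<xi>] by simp
  obtain M where M: "\<And>x. 0 < x \<Longrightarrow> x < 1 \<Longrightarrow> cmod (g (half_plane_chart \<xi> (Complex x (Im w0)))) \<le> M"
    using bdd by blast
  have \<xi>0: "\<xi> \<noteq> 0" using \<xi> by auto
  have w01: "w0 + 1 \<noteq> 0" using \<open>Re w0 = 0\<close> by (auto simp: complex_eq_iff)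
  have "isCont (half_plane_chart \<xi>) w0"
    unfolding half_plane_chart_def using w01 by (intro continuous_intros)
  moreover have "half_plane_chart \<xi> w0 = 1"
    unfolding w0_def by (rule half_plane_chart_of_inverse[OF \<xi>0]) (use ne in auto)
  moreover have "((\<lambda>x. w0 + of_real x) \<longlongrightarrow> w0 + of_real 0) (at_right (0::real))"
    by (intro tendsto_intros)
  ultimately have lim: "((\<lambda>x. half_plane_chart \<xi> (w0 + of_real x)) \<longlongrightarrow> 1) (at_right (0::real))"
    using isCont_tendsto_compose[of w0 "half_plane_chart \<xi>"] by simp
  have inball: "half_plane_chart \<xi> (w0 + of_real x) \<in> ball 0 1 - {1}" if "0 < x" for x
    using half_plane_chart_in_ball[OF \<xi>, of "w0 + of_real x"] \<open>Re w0 = 0\<close> that by auto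
  have "filterlim (\<lambda>x. half_plane_chart \<xi> (w0 + of_real x)) (at 1 within ball 0 1) (at_right (0::real))"
    unfolding filterlim_at
  proof
    have "half_plane_chart \<xi> (w0 + of_real x) \<in> ball 0 1 \<and> half_plane_chart \<xi> (w0 + of_real x) \<noteq> 1"
      if "x \<in> {0<..<1}" for x
      using inball[of x] that unfolding greaterThanLessThan_iff by blast
    from eventually_at_rightI[OF this zero_less_one] show "\<forall>\<^sub>F x in at_right 0. half_plane_chart \<xi> (w0 + of_real x) \<in> ball 0 1
        \<and> half_plane_chart \<xi> (w0 + of_real x) \<noteq> 1"
      .
  qed (rule lim)
  from filterlim_compose[OF inf this]
  have "filterlim (\<lambda>x. g (half_plane_chart \<xi> (w0 + of_real x))) at_infinity (at_right (0::real))" .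
  then have "\<forall>\<^sub>F x in at_right (0::real). M + 1 \<le> cmod (g (half_plane_chart \<xi> (w0 + of_real x)))"
    by (rule filterlim_at_infinity_imp_norm_at_top[THEN filterlim_at_top[THEN iffD1], rule_format])
  moreover have "\<forall>\<^sub>F x in at_right (0::real). 0 < x \<and> x < 1"
    by (rule eventually_at_rightI[of 0 1]) auto
  ultimately have "\<forall>\<^sub>F x in at_right (0::real). False"
  proof eventually_elim
    case (elim x)
    have "w0 + of_real x = Complex x (Im w0)" using \<open>Re w0 = 0\<close> by (simp add: complex_eq_iff)
    with elim M[of x] show ?case by simp
  qed
  then show False by simp
qed

section \<open>The growth estimate\<close>

theorem theorem3p1:
  fixes \<alpha> :: real and g :: "complex \<Rightarrow> complex"
  assumes "0 < \<alpha>" and "\<alpha> < 1"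
    and "unbounded_convex_mapping g"
    and "filterlim g at_infinity (at 1 within ball 0 1)"
    and "angle_at_infinity (g ` ball 0 1) = pi * \<alpha>"
  shows "\<exists>\<delta>>0. \<forall>\<^sub>F z in at 1 within ball 0 1. norm (1 - z) powr \<alpha> * norm (g z) \<ge> \<delta>"
proof -
  have g: "g holomorphic_on ball 0 1" "inj_on g (ball 0 1)" "convex (g ` ball 0 1)"
    using assms(3) by (auto simp: unbounded_convex_mapping_def convex_mapping_def)
  obtain \<xi> F where \<xi>: "cmod \<xi> = 1" and F: "F holomorphic_on right_half_plane"
      and Fg: "\<And>w. 0 < Re w \<Longrightarrow> cmod (F w) = cmod (g (half_plane_chart \<xi> w))"
      and F': "\<And>w. 0 < Re w \<Longrightarrow> deriv F w \<noteq> 0"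
        "\<And>w s. 0 < Re w \<Longrightarrow> \<bar>s\<bar> < pi * \<alpha> / 2 \<Longrightarrow> 0 \<le> Re (cis s * deriv F w)"
    using half_plane_model[OF g assms(1,2,5)] by metis
  have F'hol: "deriv F holomorphic_on right_half_plane"
    by (rule holomorphic_deriv[OF F open_halfspace_Re_gt])
  note est = narrow_range_estimates[OF assms(1,2) F'hol F']
  obtain C where C: "C > 0" "\<And>w. 0 < Re w \<Longrightarrow> cmod (deriv F w) \<le> C * ((cmod (w + 1))\<^sup>2 / Re w) powr (1 - \<alpha>)"
    using est(3) by blast
  have "\<xi> = 1"
  proof (rule boundary_point_eq_one[OF \<xi> assms(4)])
    fix \<eta>
    obtain M where "\<And>x. 0 < x \<Longrightarrow> x < 1 \<Longrightarrow> cmod (F (Complex x \<eta>)) \<le> M"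
      using bounded_near_boundary_point[OF assms(1,2) F C] by blast
    then show "\<exists>M. \<forall>x. 0 < x \<longrightarrow> x < 1 \<longrightarrow> cmod (g (half_plane_chart \<xi> (Complex x \<eta>))) \<le> M"
      by (intro exI[of _ M]) (simp flip: Fg)
  qed
  define k where "k = sin (pi * \<alpha> / 2)"
  have "pi * \<alpha> < pi * 1" using assms by (intro mult_strict_left_mono) auto
  then have k: "0 < k" "k \<le> 1"
    unfolding k_def using assms(1) pi_gt_zero by (auto intro!: sin_gt_zero)
  obtain c where c: "c > 0" "\<And>w. 0 < Re w \<Longrightarrow> c * (Re w / (cmod (w + 1))\<^sup>2) powr (1 - \<alpha>) \<le> cmod (deriv F w)"
    using est(2) by blast
  obtain \<delta> R where \<delta>: "0 < \<delta>" and growth: "\<And>w. 0 < Re w \<Longrightarrow> R \<le> cmod w \<Longrightarrow> \<delta> * cmod w powr \<alpha> \<le> cmod (F w)"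
    using growth_in_half_plane[OF assms(1,2) F k est(1)[folded k_def] c] by metis
  have "\<forall>\<^sub>F z in at 1 within ball 0 1. \<delta> \<le> cmod (1 - z) powr \<alpha> * cmod (g z)"
    unfolding eventually_at
  proof (intro exI conjI ballI impI)
    show "0 < min 1 (1 / (\<bar>R\<bar> + 1))" by simp
    fix z :: complex assume zb: "z \<in> ball 0 1" and "z \<noteq> 1 \<and> dist z 1 < min 1 (1 / (\<bar>R\<bar> + 1))"
    then have z: "z \<noteq> 1" "cmod (1 - z) < 1" "cmod (1 - z) < 1 / (\<bar>R\<bar> + 1)"
      by (simp_all only: dist_norm min_less_iff_conj norm_minus_commute[of z] simp_thms not_False_eq_True)
    define w where "w = (1 + z) / (1 - z)"
    have num: "1 \<le> cmod (1 + z)"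
    proof -
      have "1 + z = 2 - (1 - z)" by simp
      then have "cmod (1 + z) \<ge> 2 - cmod (1 - z)" using norm_triangle_ineq2[of 2 "1 - z"] by simp
      then show ?thesis using z by simp
    qed
    have prod: "cmod (1 - z) * cmod w = cmod (1 + z)"
      using z by (simp add: w_def norm_divide)
    have pos: "0 < cmod (1 - z)" using z by simp
    have Rew: "0 < Re w"
      unfolding w_def Re_Cayley[of 1 z, simplified] using zb z moebius_denominator_nonzero[of z 1]
      by (simp add: abs_square_less_1)
    have "R * cmod (1 - z) \<le> (\<bar>R\<bar> + 1) * cmod (1 - z)" by (intro mult_right_mono) auto
    also have "\<dots> \<le> 1" using z(3) by (simp add: field_simps)
    also have "\<dots> \<le> cmod w * cmod (1 - z)" using prod num by (simp add: mult.commute)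
    finally have "R \<le> cmod w" using pos by simp
    have "half_plane_chart \<xi> w = z"
      unfolding w_def \<open>\<xi> = 1\<close> using z by (intro half_plane_chart_of_inverse) auto
    have "\<delta> * 1 \<le> \<delta> * (cmod (1 - z) * cmod w) powr \<alpha>"
      unfolding prod using num \<delta> assms(1) by (intro mult_left_mono ge_one_powr_ge_zero) auto
    also have "\<dots> = cmod (1 - z) powr \<alpha> * (\<delta> * cmod w powr \<alpha>)"
      by (simp add: powr_mult)
    also have "\<dots> \<le> cmod (1 - z) powr \<alpha> * cmod (F w)"
      by (intro mult_left_mono growth Rew \<open>R \<le> cmod w\<close>) simp
    also have "cmod (F w) = cmod (g z)" using Fg[OF Rew] \<open>half_plane_chart \<xi> w = z\<close> by simp
    finally show "\<delta> \<le> cmod (1 - z) powr \<alpha> * cmod (g z)" by simp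
  qed
  with \<delta> show ?thesis by blast
qed

end
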